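(* Assume $k(c)<0$ for all $c\in[0,1]$. For each $c\in[0,1)$ the equation (in $x\in\mathbb R$) $$\frac{\psi_\lambda(x)}{\psi'_\lambda(x)}=x-\overline x_0(c)$$ has a unique solution $\gamma(c)$, and $\gamma(c)\in(\overline x_0(c),+\infty)$; the map $\gamma$ is decreasing and $C^1$ on $[0,1)$. Define, for $c\in[0,1)$, $$W(x,c):=\begin{cases}\dfrac{\psi_\lambda(x)}{\psi_\lambda(\gamma(c))}\Big[\gamma(c)(1-c)-\lambda\Phi(c)\Big(\dfrac{\gamma(c)-\mu}{\lambda+\theta}+\dfrac{\mu}{\lambda}\Big)\Big]+\lambda\Phi(c)\Big[\dfrac{x-\mu}{\lambda+\theta}+\dfrac{\mu}{\lambda}\Big],& x<\gamma(c),\\[4pt] x(1-c),& x\ge\gamma(c),\end{cases}$$ and $W(x,1):=0$. Then $W\in W^{2,1,\infty}_{loc}(\mathbb R\times(0,1))$ and $(W,\gamma)$ satisfies: $\mathbb L_XW(x,c)-\lambda W(x,c)=-\lambda x\Phi(c)$ for $x<\gamma(c)$, $c\in[0,1)$; $W_c(x,c)\ge -x$ for all $(x,c)$; $W(x,c)=x(1-c)$ for $x\ge\gamma(c)$; $W_x(\gamma(c),c)=1-c$. Moreover $W_c(\gamma(c),c)=-\gamma(c)$, while the left limit satisfies $\lim_{x\uparrow\gamma(c)}W_{cx}(x,c)<-1$, so that $x\mapsto W_c(x,c)$ is not $C^1$ across $\gamma(c)$ (on $x>\gamma(c)$ one has $W_{cx}=-1$).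
   Context: Fix $\theta,\sigma,\mu,\lambda>0$; $\mathbb L_Xf(x):=\frac12\sigma^2f''(x)+\theta(\mu-x)f'(x)$ acting in $x$. $\Phi\in C^2(\mathbb R)$ is nonincreasing and strictly convex with $\Phi(1)=0$; $k(c):=\lambda+\theta+\lambda\Phi'(c)$. $\zeta(c):=\int_c^1k(y)dy=(\lambda+\theta)(1-c)-\lambda\Phi(c)$ (negative on $[0,1)$ under the hypothesis), and $\overline x_0(c):=\theta\mu\Phi(c)/\zeta(c)$ for $c\in[0,1)$. $\psi_\lambda(x):=e^{\frac{\theta(x-\mu)^2}{2\sigma^2}}D_{-\lambda/\theta}\big(-\frac{(x-\mu)\sqrt{2\theta}}{\sigma}\big)$, with $D_\alpha(z)=\frac{e^{-z^2/4}}{\Gamma(-\alpha)}\int_0^\infty t^{-\alpha-1}e^{-t^2/2-zt}dt$ ($\alpha<0$) the parabolic cylinder function; $\psi_\lambda$ is the positive, strictly increasing, strictly convex solution of $\mathbb L_Xf=\lambda f$. $W^{2,1,\infty}_{loc}$ denotes functions whose weak derivatives $W_x,W_{xx},W_c$ are locally essentially bounded. *)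

theory Defs
  imports "HOL-Analysis.Analysis"
begin

definition strictly_convex_on :: "real set \<Rightarrow> (real \<Rightarrow> real) \<Rightarrow> bool" where
  "strictly_convex_on S f \<longleftrightarrow> convex S \<and>
     (\<forall>x\<in>S. \<forall>y\<in>S. \<forall>t. x \<noteq> y \<and> 0 < t \<and> t < 1 \<longrightarrow>
        f ((1 - t) * x + t * y) < (1 - t) * f x + t * f y)"

text \<open>D_alpha(z) for alpha < 0 (integral representation).\<close>
definition pcD :: "real \<Rightarrow> real \<Rightarrow> real" where
  "pcD \<alpha> z = exp (- (z\<^sup>2) / 4) / Gamma (- \<alpha>) *
      (LBINT t:{0<..}. t powr (- \<alpha> - 1) * exp (- (t\<^sup>2) / 2 - z * t))"

definition psi :: "real \<Rightarrow> real \<Rightarrow> real \<Rightarrow> real \<Rightarrow> real \<Rightarrow> real" where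
  "psi th sg mu lam x =
     exp (th * (x - mu)\<^sup>2 / (2 * sg\<^sup>2)) * pcD (- lam / th) (- (x - mu) * sqrt (2 * th) / sg)"

definition kfun :: "real \<Rightarrow> real \<Rightarrow> (real \<Rightarrow> real) \<Rightarrow> real \<Rightarrow> real" where
  "kfun th lam Phi c = lam + th + lam * deriv Phi c"

definition zeta :: "real \<Rightarrow> real \<Rightarrow> (real \<Rightarrow> real) \<Rightarrow> real \<Rightarrow> real" where
  "zeta th lam Phi c = (lam + th) * (1 - c) - lam * Phi c"

definition x0bar :: "real \<Rightarrow> real \<Rightarrow> real \<Rightarrow> (real \<Rightarrow> real) \<Rightarrow> real \<Rightarrow> real" where
  "x0bar th mu lam Phi c = th * mu * Phi c / zeta th lam Phi c"

definition gam :: "real \<Rightarrow> real \<Rightarrow> real \<Rightarrow> real \<Rightarrow> (real \<Rightarrow> real) \<Rightarrow> real \<Rightarrow> real" where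
  "gam th sg mu lam Phi c =
     (THE x. psi th sg mu lam x / deriv (psi th sg mu lam) x = x - x0bar th mu lam Phi c)"

definition Wfun :: "real \<Rightarrow> real \<Rightarrow> real \<Rightarrow> real \<Rightarrow> (real \<Rightarrow> real) \<Rightarrow> real \<Rightarrow> real \<Rightarrow> real" where
  "Wfun th sg mu lam Phi x c =
     (if c = 1 then 0
      else (let g = gam th sg mu lam Phi c in
            if x < g then
              psi th sg mu lam x / psi th sg mu lam g *
                (g * (1 - c) - lam * Phi c * ((g - mu) / (lam + th) + mu / lam))
              + lam * Phi c * ((x - mu) / (lam + th) + mu / lam)
            else x * (1 - c)))"

fun Cn :: "nat \<Rightarrow> (real \<times> real \<Rightarrow> real) \<Rightarrow> bool" where
  "Cn 0 f = continuous_on UNIV f"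
| "Cn (Suc n) f = (\<exists>D. (\<forall>p. (f has_derivative D p) (at p)) \<and> (\<forall>v. Cn n (\<lambda>p. D p v)))"

definition test_fun :: "(real \<times> real) set \<Rightarrow> (real \<times> real \<Rightarrow> real) \<Rightarrow> bool" where
  "test_fun U \<phi> \<longleftrightarrow> (\<forall>n. Cn n \<phi>) \<and> compact (closure {p. \<phi> p \<noteq> 0})
      \<and> closure {p. \<phi> p \<noteq> 0} \<subseteq> U"

definition pdx :: "(real \<times> real \<Rightarrow> real) \<Rightarrow> real \<times> real \<Rightarrow> real" where
  "pdx f p = deriv (\<lambda>y. f (y, snd p)) (fst p)"

definition pdc :: "(real \<times> real \<Rightarrow> real) \<Rightarrow> real \<times> real \<Rightarrow> real" where
  "pdc f p = deriv (\<lambda>d. f (fst p, d)) (snd p)"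

definition loc_integrable :: "(real \<times> real) set \<Rightarrow> (real \<times> real \<Rightarrow> real) \<Rightarrow> bool" where
  "loc_integrable U f \<longleftrightarrow> (\<forall>K. compact K \<and> K \<subseteq> U \<longrightarrow> set_integrable lborel K f)"

definition loc_ess_bounded :: "(real \<times> real) set \<Rightarrow> (real \<times> real \<Rightarrow> real) \<Rightarrow> bool" where
  "loc_ess_bounded U f \<longleftrightarrow>
     (\<forall>K. compact K \<and> K \<subseteq> U \<longrightarrow> (\<exists>M. AE p in lborel. p \<in> K \<longrightarrow> \<bar>f p\<bar> \<le> M))"

definition weak_dx :: "(real \<times> real) set \<Rightarrow> (real \<times> real \<Rightarrow> real) \<Rightarrow> (real \<times> real \<Rightarrow> real) \<Rightarrow> bool" where
  "weak_dx U f g \<longleftrightarrow> loc_integrable U g \<and>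
     (\<forall>\<phi>. test_fun U \<phi> \<longrightarrow>
        integral\<^sup>L lborel (\<lambda>p. f p * pdx \<phi> p) = - integral\<^sup>L lborel (\<lambda>p. g p * \<phi> p))"

definition weak_dxx :: "(real \<times> real) set \<Rightarrow> (real \<times> real \<Rightarrow> real) \<Rightarrow> (real \<times> real \<Rightarrow> real) \<Rightarrow> bool" where
  "weak_dxx U f g \<longleftrightarrow> loc_integrable U g \<and>
     (\<forall>\<phi>. test_fun U \<phi> \<longrightarrow>
        integral\<^sup>L lborel (\<lambda>p. f p * pdx (pdx \<phi>) p) = integral\<^sup>L lborel (\<lambda>p. g p * \<phi> p))"

definition weak_dc :: "(real \<times> real) set \<Rightarrow> (real \<times> real \<Rightarrow> real) \<Rightarrow> (real \<times> real \<Rightarrow> real) \<Rightarrow> bool" where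
  "weak_dc U f g \<longleftrightarrow> loc_integrable U g \<and>
     (\<forall>\<phi>. test_fun U \<phi> \<longrightarrow>
        integral\<^sup>L lborel (\<lambda>p. f p * pdc \<phi> p) = - integral\<^sup>L lborel (\<lambda>p. g p * \<phi> p))"

definition W21inf_loc :: "(real \<times> real) set \<Rightarrow> (real \<times> real \<Rightarrow> real) \<Rightarrow> bool" where
  "W21inf_loc U f \<longleftrightarrow> loc_integrable U f \<and> loc_ess_bounded U f \<and>
     (\<exists>gx gxx gc. weak_dx U f gx \<and> weak_dxx U f gxx \<and> weak_dc U f gc \<and>
        loc_ess_bounded U gx \<and> loc_ess_bounded U gxx \<and> loc_ess_bounded U gc)"

end

(*
  In the integral representation of psi the Gaussian prefactors cancel, leaving the exponential
  moments of t^(a-1) exp(-t^2/2) with a = lam/th. Differentiation, the equation L psi = lam psi and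
  log-convexity all come from these moments.

  Log-convexity of psi makes h(x) = x - psi(x)/psi'(x) satisfy h' >= 1, so h is a bijection with
  Lipschitz inverse and gamma = h^{-1} o x0. Strict convexity of Phi gives x0' < 0.

  Since x (1 - c) minus the affine particular solution equals zeta(c) (x - x0(c)) / (lam + th), the
  free-boundary equation says precisely that A(c) psi(x) + (particular solution) with
  A = zeta / ((lam + th) psi'(gamma)) meets x (1 - c) with matching value and slope. Differentiating in c,
  the slope at gamma of x |-> W_c is -1 - zeta gamma' psi'' / ((lam + th) psi') < -1.

  The weak derivatives are the classical ones: W is C^1, and for fixed c the continuous function
  W_x(., c) is C^1 off the single point gamma(c), so one-dimensional integration by parts and Fubini
  suffice.
*)
theory Submission
  imports Defs "HOL-Real_Asymp.Real_Asymp"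
begin

section \<open>Exponential moments and the function \<open>\<psi>\<close>\<close>

text \<open>With this normalisation, convergence at the origin is exactly \<open>s > 0\<close>, and
  differentiating in \<open>y\<close> raises \<open>s\<close> by one.\<close>

definition gauss_moment :: "real \<Rightarrow> real \<Rightarrow> real" where
  "gauss_moment s y = (LBINT t:{0<..}. t powr (s - 1) * exp (- (t\<^sup>2) / 2 + y * t))"

text \<open>Nonnegativity of the square of \<open>t - (y + 1)\<close> bounds the Gaussian exponent
  by \<open>(y + 1)\<^sup>2 / 2 - t\<close>, so a constant multiple of the Gamma integrand
  dominates.\<close>

lemma gauss_moment_integrable:
  assumes "s > 0"
  shows "set_integrable lborel {0<..} (\<lambda>t::real. t powr (s - 1) * exp (- (t\<^sup>2) / 2 + y * t))"
proof -
  let ?g = "\<lambda>t. indicator {0..} t * t powr (s - 1) / exp t"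
  have "integrable lborel ?g"
  proof (rule integrableI_bounded)
    have "(\<integral>\<^sup>+ t. ennreal (norm (?g t)) \<partial>lborel) = (\<integral>\<^sup>+ t. ennreal (?g t) \<partial>lborel)"
      by (intro nn_integral_cong) (auto simp: indicator_def)
    also have "\<dots> = ennreal (Gamma s)"
      using Gamma_conv_nn_integral_real[OF assms] by simp
    finally show "(\<integral>\<^sup>+ t. ennreal (norm (?g t)) \<partial>lborel) < \<infinity>" by simp
  qed measurable
  hence "integrable lborel (\<lambda>t. exp ((y + 1)\<^sup>2 / 2) * ?g t)" by (intro integrable_mult_right)
  thus ?thesis unfolding set_integrable_def
  proof (rule Bochner_Integration.integrable_bound)
    show "AE t in lborel. norm (indicator {0<..} t *\<^sub>R (t powr (s - 1) * exp (- t\<^sup>2 / 2 + y * t)))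
       \<le> norm (exp ((y + 1)\<^sup>2 / 2) * ?g t)"
    proof (intro AE_I2)
      fix t :: real
      have "0 \<le> (t - (y + 1))\<^sup>2" by simp
      hence "- t\<^sup>2 / 2 + y * t \<le> (y + 1)\<^sup>2 / 2 - t" by (simp add: power2_eq_square algebra_simps)
      hence "exp (- t\<^sup>2 / 2 + y * t) \<le> exp ((y + 1)\<^sup>2 / 2) / exp t"
        by (simp flip: exp_diff)
      thus "norm (indicator {0<..} t *\<^sub>R (t powr (s - 1) * exp (- t\<^sup>2 / 2 + y * t)))
        \<le> norm (exp ((y + 1)\<^sup>2 / 2) * ?g t)"
        using mult_left_mono[of "exp (- t\<^sup>2 / 2 + y * t)" "exp ((y + 1)\<^sup>2 / 2) / exp t" "t powr (s - 1)"]
        by (auto simp: indicator_def abs_mult mult_ac)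
    qed
  qed measurable
qed

lemma gauss_moment_nonneg: "gauss_moment s y \<ge> 0"
  unfolding gauss_moment_def set_lebesgue_integral_def by (intro integral_nonneg_AE) (auto simp: indicator_def)

text \<open>A zero integral would make the integrand, which is positive on the half-line, vanish
  almost everywhere on (0,1), a set of positive measure.\<close>

lemma gauss_moment_pos:
  assumes "s > 0"
  shows "gauss_moment s y > 0"
proof -
  let ?f = "\<lambda>t. indicator {0<..} t *\<^sub>R (t powr (s - 1) * exp (- t\<^sup>2 / 2 + y * t)) :: real"
  have int: "integrable lborel ?f"
    using gauss_moment_integrable[OF assms] unfolding set_integrable_def .
  have "gauss_moment s y \<noteq> 0"
  proof
    assume "gauss_moment s y = 0"
    hence "AE t in lborel. ?f t = 0"
      using integral_nonneg_eq_0_iff_AE[OF int]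
      by (auto simp: gauss_moment_def set_lebesgue_integral_def)
    hence "AE t in lborel. t \<notin> {0<..<1::real}"
      by eventually_elim (auto simp: indicator_def)
    hence "emeasure lborel {0<..<1::real} = 0"
      by (rule AE_iff_measurable[where N = "{0<..<1}", THEN iffD1, rotated 2]) auto
    thus False by simp
  qed
  with gauss_moment_nonneg[of s y] show ?thesis by simp
qed

text \<open>Lagrange remainder of order two; it is the pointwise estimate behind differentiation
  under the integral sign.\<close>

lemma exp_second_order_bound: "\<bar>exp u - 1 - u\<bar> \<le> u\<^sup>2 * exp \<bar>u\<bar>" for u :: real
proof -
  obtain v where v: "\<bar>v\<bar> \<le> \<bar>u\<bar>" "exp u = (\<Sum>m<2. u ^ m / fact m) + exp v / fact 2 * u ^ 2"
    using Maclaurin_exp_le[of u 2] by auto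
  have ev: "exp v \<le> exp \<bar>u\<bar>" using v(1) by simp
  have "\<bar>exp u - 1 - u\<bar> = exp v / 2 * u\<^sup>2"
    using v(2) by (simp add: numeral_2_eq_2)
  also have "\<dots> \<le> exp \<bar>u\<bar> * u\<^sup>2"
    using ev exp_gt_zero[of v] by (intro mult_right_mono; (linarith | simp))
  finally show ?thesis by (simp add: mult_ac)
qed

lemma powr_moment_shift:
  fixes t :: real
  assumes "t > 0"
  shows "t powr (s + 1 - 1) = t * t powr (s - 1)" "t powr (s + 2 - 1) = t\<^sup>2 * t powr (s - 1)"
  using assms by (auto simp: powr_mult_base power2_eq_square algebra_simps)

text \<open>Differentiation under the integral in quantitative form. For small \<open>h\<close> the
  factor \<open>exp \<bar>h * t\<bar>\<close> is at most \<open>exp t\<close>, which is absorbed by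
  shifting \<open>y\<close> by one, while the factor \<open>t\<^sup>2\<close> raises
  \<open>s\<close> by two.\<close>

lemma gauss_moment_shift_bound:
  assumes "s > 0" "\<bar>h\<bar> \<le> 1"
  shows "\<bar>gauss_moment s (y + h) - gauss_moment s y - h * gauss_moment (s + 1) y\<bar>
    \<le> h\<^sup>2 * gauss_moment (s + 2) (y + 1)"
proof -
  define f :: "real \<Rightarrow> real \<Rightarrow> real \<Rightarrow> real" where
    "f = (\<lambda>s y t. indicator {0<..} t *\<^sub>R (t powr (s - 1) * exp (- t\<^sup>2 / 2 + y * t)))"
  have moment: "integral\<^sup>L lborel (f r z) = gauss_moment r z" for r z
    by (simp add: gauss_moment_def set_lebesgue_integral_def f_def)
  have int: "integrable lborel (f r z)" if "r > 0" for r z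
    using gauss_moment_integrable[OF that] unfolding set_integrable_def f_def .
  have "gauss_moment s (y + h) - gauss_moment s y - h * gauss_moment (s + 1) y
      = (LINT t|lborel. f s (y + h) t - f s y t - h * f (s + 1) y t)"
    using assms by (simp add: moment int)
  also have "\<bar>\<dots>\<bar> \<le> (LINT t|lborel. h\<^sup>2 * f (s + 2) (y + 1) t)"
    unfolding real_norm_def[symmetric]
  proof (rule Bochner_Integration.integral_norm_bound_integral)
    fix t :: real
    show "norm (f s (y + h) t - f s y t - h * f (s + 1) y t) \<le> h\<^sup>2 * f (s + 2) (y + 1) t"
    proof (cases "t > 0")
      case True
      let ?w = "t powr (s - 1) * exp (- t\<^sup>2 / 2 + y * t)"
      have E: "exp (- t\<^sup>2 / 2 + (y + h) * t) = exp (- t\<^sup>2 / 2 + y * t) * exp (h * t)"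
      proof -
        have "- t\<^sup>2 / 2 + (y + h) * t = (- t\<^sup>2 / 2 + y * t) + h * t" by (simp add: algebra_simps)
        thus ?thesis by (simp only: exp_add)
      qed
      have "f s (y + h) t - f s y t - h * f (s + 1) y t = ?w * (exp (h * t) - 1 - h * t)"
        using True powr_moment_shift(1)[OF True, of s] unfolding f_def E
        by (simp add: right_diff_distrib)
      also have "norm \<dots> \<le> ?w * ((h * t)\<^sup>2 * exp t)"
      proof -
        have "\<bar>h * t\<bar> \<le> t" using True assms(2) by (simp add: abs_mult)
        hence "(h * t)\<^sup>2 * exp \<bar>h * t\<bar> \<le> (h * t)\<^sup>2 * exp t" by (intro mult_left_mono) auto
        with exp_second_order_bound[of "h * t"] show ?thesis
          by (simp add: abs_mult mult_left_mono)
      qed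
      also have "\<dots> = h\<^sup>2 * f (s + 2) (y + 1) t"
      proof -
        have "- t\<^sup>2 / 2 + (y + 1) * t = (- t\<^sup>2 / 2 + y * t) + t" by (simp add: algebra_simps)
        hence E: "exp (- t\<^sup>2 / 2 + (y + 1) * t) = exp (- t\<^sup>2 / 2 + y * t) * exp t" by (simp only: exp_add)
        have "f (s + 2) (y + 1) t = t\<^sup>2 * t powr (s - 1) * (exp (- t\<^sup>2 / 2 + y * t) * exp t)"
          using True unfolding f_def E powr_moment_shift(2)[OF True] by simp
        thus ?thesis by (simp add: power_mult_distrib mult_ac)
      qed
      finally show ?thesis .
    qed (simp add: f_def)
  qed (use assms in \<open>simp_all add: int\<close>)
  also have "\<dots> = h\<^sup>2 * gauss_moment (s + 2) (y + 1)"
    by (simp add: moment)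
  finally show ?thesis .
qed

lemma gauss_moment_deriv:
  assumes "s > 0"
  shows "(gauss_moment s has_real_derivative gauss_moment (s + 1) y) (at y)"
  unfolding DERIV_def
proof (subst LIM_zero_iff [symmetric], rule Lim_null_comparison)
  show "\<forall>\<^sub>F h in at 0. norm ((gauss_moment s (y + h) - gauss_moment s y) / h - gauss_moment (s + 1) y)
      \<le> \<bar>h\<bar> * gauss_moment (s + 2) (y + 1)"
    unfolding eventually_at
  proof (intro exI[of _ 1] conjI ballI impI)
    fix h :: real assume h: "h \<noteq> 0 \<and> dist h 0 < 1"
    have "(gauss_moment s (y + h) - gauss_moment s y) / h - gauss_moment (s + 1) y
       = (gauss_moment s (y + h) - gauss_moment s y - h * gauss_moment (s + 1) y) / h"
      using h by (simp add: field_simps)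
    also have "norm \<dots> \<le> h\<^sup>2 * gauss_moment (s + 2) (y + 1) / \<bar>h\<bar>"
      using gauss_moment_shift_bound[OF assms, of h y] h by (simp add: divide_right_mono)
    also have "\<dots> = \<bar>h\<bar> * gauss_moment (s + 2) (y + 1)"
      using h by (simp add: field_simps power2_eq_square)
    finally show "norm ((gauss_moment s (y + h) - gauss_moment s y) / h - gauss_moment (s + 1) y)
      \<le> \<bar>h\<bar> * gauss_moment (s + 2) (y + 1)" .
  qed simp
  show "((\<lambda>h. \<bar>h\<bar> * gauss_moment (s + 2) (y + 1)) \<longlongrightarrow> 0) (at 0)"
    by (auto intro!: tendsto_eq_intros)
qed

text \<open>Serves both the recurrence and the Cauchy-Schwarz quadratic, whose integrands combine
  three consecutive moments.\<close>

lemma gauss_moment_linear_combination: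
  assumes "s > 0"
  defines "w \<equiv> \<lambda>y r t. t powr (r - 1) * exp (- t\<^sup>2 / 2 + y * t)"
  shows "set_integrable lborel {0<..} (\<lambda>t. a * w y s t + b * w y (s + 1) t + c * w y (s + 2) t)" (is ?I)
    and "(LBINT t:{0<..}. a * w y s t + b * w y (s + 1) t + c * w y (s + 2) t)
      = a * gauss_moment s y + b * gauss_moment (s + 1) y + c * gauss_moment (s + 2) y"
proof -
  have int: "set_integrable lborel {0<..} (\<lambda>t. a * w y r t)" if "r > 0" for r a
    unfolding w_def by (intro set_integrable_mult_right gauss_moment_integrable that)
  have i: "set_integrable lborel {0<..} (\<lambda>t. a * w y s t)"
    "set_integrable lborel {0<..} (\<lambda>t. b * w y (s + 1) t)"
    "set_integrable lborel {0<..} (\<lambda>t. c * w y (s + 2) t)"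
    using assms(1) by (auto intro: int)
  note i' = set_integral_add[OF i(1,2)]
  show ?I by (rule set_integral_add(1)[OF i'(1) i(3)])
  have *: "(LBINT t:{0<..}. a * w y r t) = a * gauss_moment r y" for a r
    by (simp add: gauss_moment_def w_def)
  show "(LBINT t:{0<..}. a * w y s t + b * w y (s + 1) t + c * w y (s + 2) t)
      = a * gauss_moment s y + b * gauss_moment (s + 1) y + c * gauss_moment (s + 2) y"
    by (simp only: set_integral_add(2)[OF i'(1) i(3)] i'(2) *)
qed

text \<open>Integration by parts: the derivative of
  \<open>t powr s * exp (- t\<^sup>2 / 2 + y * t)\<close> integrates to zero over the
  half-line.\<close>

lemma gauss_moment_recurrence:
  assumes "s > 0"
  shows "gauss_moment (s + 2) y = s * gauss_moment s y + y * gauss_moment (s + 1) y"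
proof -
  let ?w = "\<lambda>s t. t powr (s - 1) * exp (- t\<^sup>2 / 2 + y * t)"
  let ?F = "\<lambda>t. t powr s * exp (- t\<^sup>2 / 2 + y * t)"
  let ?f = "\<lambda>t. s * ?w s t + y * ?w (s + 1) t - ?w (s + 2) t"
  note f = gauss_moment_linear_combination[OF assms, of s y y "-1"]
  hence int: "set_integrable lborel {0<..} ?f" by simp
  \<comment> \<open>The two zeros are the limits of \<open>?F\<close> at infinity and at the origin;
    the latter vanishes because \<open>s > 0\<close>.\<close>
  have "(LBINT x=0..\<infinity>. ?f x) = 0 - 0"
  proof (rule interval_integral_FTC_integrable)
    fix t :: real assume "0 < ereal t" hence t: "t > 0" by simp
    show "(?F has_vector_derivative ?f t) (at t)"
      unfolding has_real_derivative_iff_has_vector_derivative[symmetric]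
    proof (rule DERIV_cong)
      show "(?F has_real_derivative s * t powr (s - 1) * exp (- t\<^sup>2 / 2 + y * t)
          + t powr s * (exp (- t\<^sup>2 / 2 + y * t) * (y - t))) (at t)"
        using t by (auto intro!: derivative_eq_intros)
      have "t powr s = t powr (s + 1 - 1)" "t * t powr s = t powr (s + 2 - 1)"
        using powr_moment_shift(2)[OF t, of s] powr_moment_shift(1)[OF t, of s]
        by (auto simp: power2_eq_square)
      thus "s * t powr (s - 1) * exp (- t\<^sup>2 / 2 + y * t) + t powr s * (exp (- t\<^sup>2 / 2 + y * t) * (y - t)) = ?f t"
        by (simp add: algebra_simps)
    qed
    show "isCont ?f t" using t by (auto intro!: continuous_intros)
  next
    show "set_integrable lborel (einterval 0 \<infinity>) ?f"
      using int by (simp add: einterval_def greaterThan_def)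
    have "(?F \<longlongrightarrow> 0) (at_right 0)"
      using assms by real_asymp
    thus "((?F \<circ> real_of_ereal) \<longlongrightarrow> 0) (at_right 0)"
      by (simp add: ereal_tendsto_simps1 zero_ereal_def)
    have "(?F \<longlongrightarrow> 0) at_top"
      by real_asymp
    thus "((?F \<circ> real_of_ereal) \<longlongrightarrow> 0) (at_left \<infinity>)"
      by (simp add: ereal_tendsto_simps1)
  qed auto
  hence "(LBINT t:{0<..}. ?f t) = 0"
    by (simp add: interval_lebesgue_integral_def einterval_def greaterThan_def)
  with f(2) show ?thesis by simp
qed

text \<open>Cauchy--Schwarz, from the discriminant of \<open>r \<mapsto> \<integral> (r - t)\<^sup>2 d\<mu>(t) \<ge> 0\<close>.\<close>

lemma gauss_moment_log_convex:
  assumes "s > 0"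
  shows "(gauss_moment (s + 1) y)\<^sup>2 \<le> gauss_moment s y * gauss_moment (s + 2) y"
proof -
  let ?w = "\<lambda>s t. t powr (s - 1) * exp (- t\<^sup>2 / 2 + y * t)"
  have *: "0 \<le> r\<^sup>2 * gauss_moment s y - 2 * r * gauss_moment (s + 1) y + gauss_moment (s + 2) y" for r
  proof -
    have "0 \<le> (LBINT t:{0<..}. r\<^sup>2 * ?w s t + (- 2 * r) * ?w (s + 1) t + 1 * ?w (s + 2) t)"
      unfolding set_lebesgue_integral_def
    proof (intro integral_nonneg_AE AE_I2)
      fix t :: real
      have "r\<^sup>2 * ?w s t + (- 2 * r) * ?w (s + 1) t + 1 * ?w (s + 2) t = (r - t)\<^sup>2 * ?w s t" if "t > 0"
        using powr_moment_shift[OF that, of s] by (simp add: power2_eq_square algebra_simps)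
      thus "0 \<le> indicator {0<..} t *\<^sub>R (r\<^sup>2 * ?w s t + (- 2 * r) * ?w (s + 1) t + 1 * ?w (s + 2) t)"
        by (cases "t > 0") auto
    qed
    also have "\<dots> = r\<^sup>2 * gauss_moment s y - 2 * r * gauss_moment (s + 1) y + gauss_moment (s + 2) y"
      by (subst gauss_moment_linear_combination(2)[OF assms]) simp
    finally show ?thesis .
  qed
  have p: "gauss_moment s y > 0" using gauss_moment_pos[OF assms] .
  show ?thesis
    \<comment> \<open>This \<open>r\<close> minimises the quadratic, so nonnegativity there is the
      discriminant inequality.\<close>
    using *[of "gauss_moment (s + 1) y / gauss_moment s y"] p
    by (simp add: power2_eq_square field_simps)
qed

section \<open>Derivatives of psi in closed form\<close>

definition psi_deriv :: "nat \<Rightarrow> real \<Rightarrow> real \<Rightarrow> real \<Rightarrow> real \<Rightarrow> real \<Rightarrow> real" where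
  "psi_deriv n th sg mu lam x =
     (sqrt (2 * th) / sg) ^ n * gauss_moment (lam / th + n) (sqrt (2 * th) / sg * (x - mu)) / Gamma (lam / th)"

lemma psi_eq_psi_deriv_0:
  assumes "th > 0" "sg > 0"
  shows "psi th sg mu lam = psi_deriv 0 th sg mu lam"
proof
  fix x
  let ?z = "- (x - mu) * sqrt (2 * th) / sg"
  have "?z\<^sup>2 / 4 = th * (x - mu)\<^sup>2 / (2 * sg\<^sup>2)"
    using assms by (simp add: power_divide power_mult_distrib power2_commute[of mu])
  hence E: "exp (th * (x - mu)\<^sup>2 / (2 * sg\<^sup>2)) * exp (- ?z\<^sup>2 / 4) = 1"
    by (simp flip: exp_add)
  have z: "- (t\<^sup>2) / 2 - ?z * t = - (t\<^sup>2) / 2 + sqrt (2 * th) / sg * (x - mu) * t" for t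
  proof -
    have "?z = - (sqrt (2 * th) / sg * (x - mu))"
      by (simp add: left_diff_distrib right_diff_distrib diff_divide_distrib mult_ac)
    thus ?thesis by simp
  qed
  have "pcD (- lam / th) ?z = exp (- ?z\<^sup>2 / 4) / Gamma (lam / th)
      * gauss_moment (lam / th) (sqrt (2 * th) / sg * (x - mu))"
    unfolding pcD_def gauss_moment_def z by simp
  hence "psi th sg mu lam x = (exp (th * (x - mu)\<^sup>2 / (2 * sg\<^sup>2)) * exp (- ?z\<^sup>2 / 4))
      * gauss_moment (lam / th) (sqrt (2 * th) / sg * (x - mu)) / Gamma (lam / th)"
    by (simp add: psi_def)
  thus "psi th sg mu lam x = psi_deriv 0 th sg mu lam x"
    unfolding E by (simp add: psi_deriv_def)
qed

text \<open>The chain rule brings down one factor \<open>sqrt (2 * th) / sg\<close> and raises the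
  moment index by one, so \<open>psi_deriv n\<close> is the \<open>n\<close>-th derivative of
  \<open>psi\<close>.\<close>

lemma psi_deriv_has_derivative:
  assumes "th > 0" "sg > 0" "lam > 0"
  shows "(psi_deriv n th sg mu lam has_real_derivative psi_deriv (Suc n) th sg mu lam x) (at x)"
proof -
  have "lam / th + n > 0" using assms by (simp add: add_pos_nonneg)
  from gauss_moment_deriv[OF this]
  have "((\<lambda>x. gauss_moment (lam / th + n) (sqrt (2 * th) / sg * (x - mu))) has_real_derivative
     gauss_moment (lam / th + Suc n) (sqrt (2 * th) / sg * (x - mu)) * (sqrt (2 * th) / sg)) (at x)"
    using assms by (intro DERIV_chain2[of "gauss_moment _"]) (auto intro!: derivative_eq_intros simp: add_ac)
  from DERIV_cdivide[OF DERIV_cmult[OF this, of "(sqrt (2 * th) / sg) ^ n"], of "Gamma (lam / th)"]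
  show ?thesis unfolding psi_deriv_def[abs_def] by (simp add: mult_ac)
qed

lemma psi_deriv_pos:
  assumes "th > 0" "sg > 0" "lam > 0"
  shows "psi_deriv n th sg mu lam x > 0"
  unfolding psi_deriv_def using assms
  by (intro divide_pos_pos mult_pos_pos zero_less_power gauss_moment_pos Gamma_real_pos add_pos_nonneg) auto

lemma psi_deriv_log_convex:
  assumes "th > 0" "sg > 0" "lam > 0"
  shows "(psi_deriv 1 th sg mu lam x)\<^sup>2 \<le> psi_deriv 0 th sg mu lam x * psi_deriv 2 th sg mu lam x"
proof -
  define K where "K = sqrt (2 * th) / sg"
  have "(gauss_moment (lam / th + 1) y)\<^sup>2 \<le> gauss_moment (lam / th) y * gauss_moment (lam / th + 2) y" for y
    using assms by (intro gauss_moment_log_convex) simp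
  from mult_left_mono[OF this[of "K * (x - mu)"], of "(K / Gamma (lam / th))\<^sup>2"]
  show ?thesis unfolding psi_deriv_def K_def[symmetric] by (simp add: power2_eq_square mult_ac)
qed

text \<open>This is the moment recurrence at \<open>s = lam / th\<close> and
  \<open>y = K * (x - mu)\<close>, rescaled by means of
  \<open>sg\<^sup>2 * K\<^sup>2 = 2 * th\<close>.\<close>

lemma psi_deriv_ode:
  assumes "th > 0" "sg > 0" "lam > 0"
  shows "1/2 * sg\<^sup>2 * psi_deriv 2 th sg mu lam x + th * (mu - x) * psi_deriv 1 th sg mu lam x
    = lam * psi_deriv 0 th sg mu lam x"
proof -
  define K where "K = sqrt (2 * th) / sg"
  define m where "m = (\<lambda>n::nat. gauss_moment (lam / th + n) (K * (x - mu)))"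
  have K: "sg\<^sup>2 * K\<^sup>2 = 2 * th" using assms by (simp add: K_def power_divide)
  have "m 2 = lam / th * m 0 + K * (x - mu) * m 1"
    unfolding m_def using gauss_moment_recurrence[of "lam / th" "K * (x - mu)"] assms by simp
  hence *: "th * m 2 = lam * m 0 + th * K * (x - mu) * m 1"
    using assms by (simp add: field_simps)
  have "1/2 * sg\<^sup>2 * (K\<^sup>2 * m 2) = th * m 2"
    using K by (simp add: mult.assoc[symmetric])
  hence "1/2 * sg\<^sup>2 * (K\<^sup>2 * m 2) + th * (mu - x) * (K * m 1) = lam * m 0"
    unfolding * by (simp add: algebra_simps)
  from arg_cong[OF this, of "\<lambda>u. u / Gamma (lam / th)"] show ?thesis
    unfolding psi_deriv_def K_def[symmetric] by (simp add: add_divide_distrib m_def)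
qed

section \<open>Weak derivatives of piecewise smooth functions\<close>

text \<open>Each \<open>Cn (Suc n)\<close> asserts the existence of its own derivative; uniqueness
  of derivatives lets a single \<open>D\<close> serve all orders.\<close>

lemma Cn_has_derivative:
  assumes "\<forall>n. Cn n \<phi>"
  obtains D where "\<And>p. (\<phi> has_derivative D p) (at p)" "\<And>n v. Cn n (\<lambda>p. D p v)"
proof -
  from assms have "Cn (Suc 0) \<phi>" by blast
  then obtain D where D: "\<And>p. (\<phi> has_derivative D p) (at p)" by auto
  have "Cn n (\<lambda>p. D p v)" for n v
  proof -
    from assms have "Cn (Suc n) \<phi>" by blast
    then obtain D' where D': "\<And>p. (\<phi> has_derivative D' p) (at p)" "\<And>v. Cn n (\<lambda>p. D' p v)" by auto
    have "D' p = D p" for p by (rule has_derivative_unique[OF D'(1) D])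
    with D'(2) show ?thesis by simp
  qed
  with D show ?thesis by (rule that)
qed

lemma pdx_eqI:
  assumes "(\<phi> has_derivative D) (at (x, c))"
  shows "((\<lambda>y. \<phi> (y, c)) has_real_derivative D (1, 0)) (at x)" "pdx \<phi> (x, c) = D (1, 0)"
proof -
  interpret D: bounded_linear D by (rule has_derivative_bounded_linear[OF assms])
  have "((\<lambda>y. \<phi> (y, c)) has_derivative (\<lambda>h. D (h, 0))) (at x)"
    by (rule has_derivative_compose[where f = "\<lambda>y. (y, c)" and g = \<phi> and x = x, OF _ assms]) (auto intro!: derivative_eq_intros)
  moreover have "(\<lambda>h. D (h, 0)) = (*) (D (1, 0))"
  proof
    show "D (h, 0) = D (1, 0) * h" for h using D.scaleR[of h "(1, 0)"] by simp
  qed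
  ultimately show "((\<lambda>y. \<phi> (y, c)) has_real_derivative D (1, 0)) (at x)"
    by (simp only: has_field_derivative_def)
  thus "pdx \<phi> (x, c) = D (1, 0)" by (simp add: pdx_def DERIV_imp_deriv)
qed

lemma pdc_eqI:
  assumes "(\<phi> has_derivative D) (at (x, c))"
  shows "((\<lambda>d. \<phi> (x, d)) has_real_derivative D (0, 1)) (at c)" "pdc \<phi> (x, c) = D (0, 1)"
proof -
  interpret D: bounded_linear D by (rule has_derivative_bounded_linear[OF assms])
  have "((\<lambda>d. \<phi> (x, d)) has_derivative (\<lambda>h. D (0, h))) (at c)"
    by (rule has_derivative_compose[where f = "\<lambda>d. (x, d)" and g = \<phi> and x = c, OF _ assms]) (auto intro!: derivative_eq_intros)
  moreover have "(\<lambda>h. D (0, h)) = (*) (D (0, 1))"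
  proof
    show "D (0, h) = D (0, 1) * h" for h using D.scaleR[of h "(0, 1)"] by simp
  qed
  ultimately show "((\<lambda>d. \<phi> (x, d)) has_real_derivative D (0, 1)) (at c)"
    by (simp only: has_field_derivative_def)
  thus "pdc \<phi> (x, c) = D (0, 1)" by (simp add: pdc_def DERIV_imp_deriv)
qed

lemma test_fun_partial_derivatives:
  assumes "test_fun U \<phi>"
  shows "((\<lambda>y. \<phi> (y, c)) has_real_derivative pdx \<phi> (x, c)) (at x)"
    and "((\<lambda>d. \<phi> (x, d)) has_real_derivative pdc \<phi> (x, c)) (at c)"
    and "continuous_on UNIV \<phi>" "continuous_on UNIV (pdx \<phi>)" "continuous_on UNIV (pdc \<phi>)"
    and "\<forall>n. Cn n (pdx \<phi>)"
proof -
  have *: "\<forall>n. Cn n \<phi>" using assms by (simp add: test_fun_def)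
  then obtain D where D: "\<And>p. (\<phi> has_derivative D p) (at p)" "\<And>n v. Cn n (\<lambda>p. D p v)"
    by (rule Cn_has_derivative) blast
  show "((\<lambda>y. \<phi> (y, c)) has_real_derivative pdx \<phi> (x, c)) (at x)"
    "((\<lambda>d. \<phi> (x, d)) has_real_derivative pdc \<phi> (x, c)) (at c)"
    using pdx_eqI[OF D(1)] pdc_eqI[OF D(1)] by simp_all
  have eq: "pdx \<phi> = (\<lambda>p. D p (1, 0))" "pdc \<phi> = (\<lambda>p. D p (0, 1))"
    using pdx_eqI(2)[OF D(1)] pdc_eqI(2)[OF D(1)] by (auto simp: fun_eq_iff)
  show "\<forall>n. Cn n (pdx \<phi>)" unfolding eq using D(2) by blast
  show "continuous_on UNIV (pdx \<phi>)" "continuous_on UNIV (pdc \<phi>)"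
    unfolding eq using D(2)[of 0] by simp_all
  show "continuous_on UNIV \<phi>" using spec[OF *, of 0] by simp
qed

lemma DERIV_eq_0_of_vanishing:
  fixes \<phi> :: "real \<Rightarrow> real"
  assumes "(\<phi> has_real_derivative D) (at t)" "closed K" "t \<notin> K" "\<And>s. s \<notin> K \<Longrightarrow> \<phi> s = 0"
  shows "D = 0"
proof -
  have "(\<phi> has_real_derivative 0) (at t)"
    by (rule has_field_derivative_transform_within_open[where f = "\<lambda>_. 0" and S = "- K"])
       (use assms in \<open>auto simp: open_Compl\<close>)
  with assms(1) show ?thesis by (rule DERIV_unique)
qed

text \<open>After Fubini, integration by parts takes place on lines, where the support of a test
  function becomes one of these slices.\<close>

lemma compact_slices:
  fixes K :: "(real \<times> real) set"
  assumes "compact K"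
  shows "compact {x. (x, c) \<in> K}" "compact {d. (x, d) \<in> K}"
proof -
  have b: "bounded (fst ` K)" "bounded (snd ` K)" and cl: "closed K"
    using assms compact_imp_bounded[OF compact_continuous_image[of K fst]]
      compact_imp_bounded[OF compact_continuous_image[of K snd]]
    by (auto simp: compact_imp_closed continuous_on_fst continuous_on_snd)
  show "compact {x. (x, c) \<in> K}" unfolding compact_eq_bounded_closed
  proof
    show "bounded {x. (x, c) \<in> K}" by (rule bounded_subset[OF b(1)]) force
    have "closed ((\<lambda>x. (x, c)) -` K)" by (intro continuous_closed_vimage cl) (auto intro!: continuous_intros)
    thus "closed {x. (x, c) \<in> K}" by (simp add: vimage_def)
  qed
  show "compact {d. (x, d) \<in> K}" unfolding compact_eq_bounded_closed
  proof
    show "bounded {d. (x, d) \<in> K}" by (rule bounded_subset[OF b(2)]) force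
    have "closed ((\<lambda>d. (x, d)) -` K)" by (intro continuous_closed_vimage cl) (auto intro!: continuous_intros)
    thus "closed {d. (x, d) \<in> K}" by (simp add: vimage_def)
  qed
qed

lemma test_fun_vanishes:
  assumes "test_fun U \<phi>" "p \<notin> closure {p. \<phi> p \<noteq> 0}"
  shows "\<phi> p = 0" "pdx \<phi> p = 0" "pdc \<phi> p = 0"
proof -
  define K where "K = closure {p. \<phi> p \<noteq> 0}"
  have K: "compact K" using assms(1) by (simp add: test_fun_def K_def)
  have z: "q \<notin> K \<Longrightarrow> \<phi> q = 0" for q using closure_subset[of "{p. \<phi> p \<noteq> 0}"] by (auto simp: K_def)
  show "\<phi> p = 0" using z assms(2) unfolding K_def by blast
  obtain x c where p: "p = (x, c)" by (cases p)
  show "pdx \<phi> p = 0" unfolding p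
    by (rule DERIV_eq_0_of_vanishing[OF test_fun_partial_derivatives(1)[OF assms(1)], of "{x. (x, c) \<in> K}"])
      (use compact_imp_closed[OF compact_slices(1)[OF K]] assms(2)[folded K_def] p z in simp_all)
  show "pdc \<phi> p = 0" unfolding p
    by (rule DERIV_eq_0_of_vanishing[OF test_fun_partial_derivatives(2)[OF assms(1)], of "{c. (x, c) \<in> K}"])
      (use compact_imp_closed[OF compact_slices(2)[OF K]] assms(2)[folded K_def] p z in simp_all)
qed

text \<open>Allows a second weak derivative to be obtained by testing twice with first
  derivatives.\<close>

lemma test_fun_pdx:
  assumes "test_fun U \<phi>"
  shows "test_fun U (pdx \<phi>)"
proof -
  have sub: "closure {p. pdx \<phi> p \<noteq> 0} \<subseteq> closure {p. \<phi> p \<noteq> 0}"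
    by (rule closure_minimal) (use test_fun_vanishes(2)[OF assms] in auto)
  moreover have "compact (closure {p. \<phi> p \<noteq> 0})" "closure {p. \<phi> p \<noteq> 0} \<subseteq> U"
    using assms by (auto simp: test_fun_def)
  ultimately show ?thesis
    using test_fun_partial_derivatives(6)[OF assms] compact_Int_closed[of "closure {p. \<phi> p \<noteq> 0}" "closure {p. pdx \<phi> p \<noteq> 0}"]
    unfolding test_fun_def by (auto simp: Int_absorb1)
qed

text \<open>On \<open>K\<close> the function \<open>g\<close> is integrable and
  \<open>\<phi>\<close> is bounded; off \<open>K\<close> the product is zero.\<close>

lemma integrable_mult_compact_support:
  fixes g \<phi> :: "real \<times> real \<Rightarrow> real"
  assumes "loc_integrable U g" "compact K" "K \<subseteq> U" "continuous_on UNIV \<phi>" "\<And>p. p \<notin> K \<Longrightarrow> \<phi> p = 0"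
  shows "integrable lborel (\<lambda>p. g p * \<phi> p)"
proof -
  have g: "integrable lborel (\<lambda>p. indicator K p *\<^sub>R g p)"
    using assms(1,2,3) by (auto simp: loc_integrable_def set_integrable_def)
  have "bounded (\<phi> ` K)"
    by (intro compact_imp_bounded compact_continuous_image assms continuous_on_subset[OF assms(4)]) auto
  then obtain M where M: "\<And>p. p \<in> K \<Longrightarrow> \<bar>\<phi> p\<bar> \<le> M" by (auto simp: bounded_iff)
  have M0: "\<bar>\<phi> p\<bar> \<le> \<bar>M\<bar>" for p
    using M[of p] assms(5)[of p] by (cases "p \<in> K") auto
  have [measurable]: "\<phi> \<in> borel_measurable borel" by (rule borel_measurable_continuous_onI[OF assms(4)])
  have m: "(\<lambda>p. indicator K p *\<^sub>R g p) \<in> borel_measurable lborel" using g by (rule borel_measurable_integrable)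
  have "integrable lborel (\<lambda>p. (indicator K p *\<^sub>R g p) * \<phi> p)"
  proof (rule Bochner_Integration.integrable_bound[OF integrable_mult_left[of "\<bar>M\<bar>"]])
    show "integrable lborel (\<lambda>p. indicator K p *\<^sub>R g p)" by (rule g)
    show "(\<lambda>p. (indicator K p *\<^sub>R g p) * \<phi> p) \<in> borel_measurable lborel"
      by (intro borel_measurable_times m) measurable
    show "AE p in lborel. norm ((indicator K p *\<^sub>R g p) * \<phi> p) \<le> norm ((indicator K p *\<^sub>R g p) * \<bar>M\<bar>)"
    proof (rule AE_I2)
      fix p
      show "norm ((indicator K p *\<^sub>R g p) * \<phi> p) \<le> norm ((indicator K p *\<^sub>R g p) * \<bar>M\<bar>)"
        unfolding real_norm_def abs_mult[of "indicator K p *\<^sub>R g p"]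
        using M0[of p] by (intro mult_left_mono) auto
    qed
  qed
  moreover have "(\<lambda>p. (indicator K p *\<^sub>R g p) * \<phi> p) = (\<lambda>p. g p * \<phi> p)"
  proof
    show "(indicator K p *\<^sub>R g p) * \<phi> p = g p * \<phi> p" for p
      using assms(5)[of p] by (cases "p \<in> K") auto
  qed
  ultimately show ?thesis by (simp only:)
qed

text \<open>The integrand is the derivative of \<open>u t * \<phi> t\<close> off a finite set. That
  product is continuous and vanishes outside \<open>K\<close>, so the fundamental theorem on an
  interval around \<open>K\<close> gives zero.\<close>

lemma integral_product_derivative_eq_0:
  fixes u v \<phi> \<phi>' :: "real \<Rightarrow> real"
  assumes K: "compact K" and S: "finite S"
    and cont: "\<And>t. t \<in> K \<Longrightarrow> isCont u t"
    and u': "\<And>t. t \<in> K \<Longrightarrow> t \<notin> S \<Longrightarrow> (u has_real_derivative v t) (at t)"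
    and \<phi>': "\<And>t. (\<phi> has_real_derivative \<phi>' t) (at t)"
    and z: "\<And>t. t \<notin> K \<Longrightarrow> \<phi> t = 0"
  shows "(LINT t|lborel. u t * \<phi>' t + v t * \<phi> t) = 0"
\<comment> \<open>In the other case the Bochner integral is 0 by convention. Fubini can therefore
  use the result on every slice, without setting aside a null set of slices.\<close>
proof (cases "integrable lborel (\<lambda>t. u t * \<phi>' t + v t * \<phi> t)")
  case True
  let ?f = "\<lambda>t. u t * \<phi>' t + v t * \<phi> t"
  have clK: "closed K" using K by (rule compact_imp_closed)
  have z': "\<phi>' t = 0" if "t \<notin> K" for t
    by (rule DERIV_eq_0_of_vanishing[OF \<phi>' clK that z])
  obtain M where M: "\<And>t. t \<in> K \<Longrightarrow> \<bar>t\<bar> \<le> M"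
    using compact_imp_bounded[OF K] by (auto simp: bounded_iff)
  \<comment> \<open>The added 1 places the endpoints of the interval strictly outside
    \<open>K\<close>, where \<open>\<phi>\<close> is zero.\<close>
  define b where "b = \<bar>M\<bar> + 1"
  have bK: "t \<in> K \<Longrightarrow> \<bar>t\<bar> < b" for t using M[of t] by (auto simp: b_def)
  \<comment> \<open>Nothing is known about \<open>u\<close> outside \<open>K\<close>, but the
    product is identically zero on that open set.\<close>
  have off: "((\<lambda>t. u t * \<phi> t) has_real_derivative ?f t) (at t)" if "t \<notin> K" for t
  proof -
    have "((\<lambda>t. u t * \<phi> t) has_real_derivative 0) (at t)"
      by (rule has_field_derivative_transform_within_open[where f = "\<lambda>_. 0" and S = "- K"])
         (use that z clK in \<open>auto simp: open_Compl\<close>)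
    thus ?thesis using z'[OF that] z[OF that] by simp
  qed
  have d: "((\<lambda>t. u t * \<phi> t) has_real_derivative ?f t) (at t)" if "t \<notin> S" for t
    using off[of t] DERIV_mult[OF u'[OF _ that] \<phi>'[of t]]
    by (cases "t \<in> K") (auto simp: mult.commute add.commute)
  have c: "isCont (\<lambda>t. u t * \<phi> t) t" for t
    using off[of t] cont[of t] DERIV_isCont[OF \<phi>'[of t]]
    by (cases "t \<in> K") (auto intro: DERIV_isCont)
  have FTC: "(?f has_integral (u b * \<phi> b - u (- b) * \<phi> (- b))) {- b..b}"
    by (rule fundamental_theorem_of_calculus_interior_strong[OF S])
       (use d c in \<open>auto simp: b_def has_real_derivative_iff_has_vector_derivative[symmetric]
          intro: continuous_at_imp_continuous_on\<close>)
  have "(?f has_integral 0) {- b..b}"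
  proof -
    have "b \<notin> K" "- b \<notin> K" using bK[of b] bK[of "- b"] by (auto simp: b_def)
    with z have "\<phi> b = 0" "\<phi> (- b) = 0" by auto
    with FTC show ?thesis by simp
  qed
  hence "(?f has_integral 0) UNIV"
  proof (rule has_integral_on_superset)
    fix t assume "t \<notin> {- b..b}"
    hence "t \<notin> K" using bK[of t] by auto
    thus "?f t = 0" using z z' by simp
  qed simp
  with has_integral_integral_lborel[OF True] show ?thesis by (rule has_integral_unique)
qed (rule not_integrable_integral_eq)

text \<open>On each horizontal line finitely many points of non-differentiability are allowed.
  Continuity of \<open>f\<close> along the line rules out jumps, which would contribute boundary
  terms.\<close>

lemma weak_dxI:
  assumes f: "loc_integrable U f" and g: "loc_integrable U g" and S: "\<And>c. finite (S c)"
    and cont: "\<And>x c. (x, c) \<in> U \<Longrightarrow> isCont (\<lambda>y. f (y, c)) x"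
    and der: "\<And>x c. (x, c) \<in> U \<Longrightarrow> x \<notin> S c \<Longrightarrow> ((\<lambda>y. f (y, c)) has_real_derivative g (x, c)) (at x)"
  shows "weak_dx U f g"
  unfolding weak_dx_def
proof (intro conjI allI impI g)
  fix \<phi> assume \<phi>: "test_fun U \<phi>"
  define K where "K = closure {p. \<phi> p \<noteq> 0}"
  have K: "compact K" "K \<subseteq> U" using \<phi> by (auto simp: test_fun_def K_def)
  note z = test_fun_vanishes[OF \<phi>, folded K_def] and p = test_fun_partial_derivatives[OF \<phi>]
  have i: "integrable lborel (\<lambda>p. f p * pdx \<phi> p)" "integrable lborel (\<lambda>p. g p * \<phi> p)"
    by (rule integrable_mult_compact_support[OF f K p(4) z(2)] integrable_mult_compact_support[OF g K p(3) z(1)]; assumption)+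
  hence int: "integrable lborel (\<lambda>p. f p * pdx \<phi> p + g p * \<phi> p)" by (rule Bochner_Integration.integrable_add)
  have "(LINT p|lborel. f p * pdx \<phi> p + g p * \<phi> p)
      = (LINT c|lborel. LINT x|lborel. f (x, c) * pdx \<phi> (x, c) + g (x, c) * \<phi> (x, c))"
    using lborel_pair.integral_snd[of "\<lambda>x c. f (x, c) * pdx \<phi> (x, c) + g (x, c) * \<phi> (x, c)"] int
    by (simp add: lborel_prod case_prod_unfold)
  also have "\<dots> = (LINT c|(lborel :: real measure). 0)"
  proof (intro Bochner_Integration.integral_cong refl)
    fix c
    show "(LINT x|lborel. f (x, c) * pdx \<phi> (x, c) + g (x, c) * \<phi> (x, c)) = 0"
      by (rule integral_product_derivative_eq_0[OF compact_slices(1)[OF K(1), of c] S[of c]])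
         (use K(2) cont der p(1) z(1) in auto)
  qed
  finally show "integral\<^sup>L lborel (\<lambda>p. f p * pdx \<phi> p) = - integral\<^sup>L lborel (\<lambda>p. g p * \<phi> p)"
    using i by simp
qed

lemma weak_dcI:
  assumes f: "loc_integrable U f" and g: "loc_integrable U g" and S: "\<And>x. finite (S x)"
    and cont: "\<And>x c. (x, c) \<in> U \<Longrightarrow> isCont (\<lambda>d. f (x, d)) c"
    and der: "\<And>x c. (x, c) \<in> U \<Longrightarrow> c \<notin> S x \<Longrightarrow> ((\<lambda>d. f (x, d)) has_real_derivative g (x, c)) (at c)"
  shows "weak_dc U f g"
  unfolding weak_dc_def
proof (intro conjI allI impI g)
  fix \<phi> assume \<phi>: "test_fun U \<phi>"
  define K where "K = closure {p. \<phi> p \<noteq> 0}"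
  have K: "compact K" "K \<subseteq> U" using \<phi> by (auto simp: test_fun_def K_def)
  note z = test_fun_vanishes[OF \<phi>, folded K_def] and p = test_fun_partial_derivatives[OF \<phi>]
  have i: "integrable lborel (\<lambda>p. f p * pdc \<phi> p)" "integrable lborel (\<lambda>p. g p * \<phi> p)"
    by (rule integrable_mult_compact_support[OF f K p(5) z(3)] integrable_mult_compact_support[OF g K p(3) z(1)]; assumption)+
  hence int: "integrable lborel (\<lambda>p. f p * pdc \<phi> p + g p * \<phi> p)" by (rule Bochner_Integration.integrable_add)
  have "(LINT p|lborel. f p * pdc \<phi> p + g p * \<phi> p)
      = (LINT x|lborel. LINT c|lborel. f (x, c) * pdc \<phi> (x, c) + g (x, c) * \<phi> (x, c))"
    using lborel_pair.integral_fst'[of "\<lambda>p. f p * pdc \<phi> p + g p * \<phi> p"] int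
    by (simp add: lborel_prod)
  also have "\<dots> = (LINT x|(lborel :: real measure). 0)"
  proof (intro Bochner_Integration.integral_cong refl)
    fix x
    show "(LINT c|lborel. f (x, c) * pdc \<phi> (x, c) + g (x, c) * \<phi> (x, c)) = 0"
      by (rule integral_product_derivative_eq_0[OF compact_slices(2)[OF K(1), of x] S[of x]])
         (use K(2) cont der p(2) z(1) in auto)
  qed
  finally show "integral\<^sup>L lborel (\<lambda>p. f p * pdc \<phi> p) = - integral\<^sup>L lborel (\<lambda>p. g p * \<phi> p)"
    using i by simp
qed

text \<open>The first hypothesis is tested with \<open>pdx \<phi>\<close> and the second with
  \<open>\<phi>\<close>; the two minus signs cancel.\<close>

lemma weak_dxxI:
  assumes "weak_dx U f g" "weak_dx U g h"
  shows "weak_dxx U f h"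
  using assms test_fun_pdx unfolding weak_dx_def weak_dxx_def by simp

lemma continuous_loc_ess_bounded:
  assumes "continuous_on U f"
  shows "loc_ess_bounded U f"
  unfolding loc_ess_bounded_def
proof (intro allI impI, elim conjE)
  fix K assume K: "compact K" "K \<subseteq> U"
  have "bounded (f ` K)"
    by (intro compact_imp_bounded compact_continuous_image continuous_on_subset[OF assms] K)
  then obtain M where "\<And>p. p \<in> K \<Longrightarrow> \<bar>f p\<bar> \<le> M" by (auto simp: bounded_iff)
  thus "\<exists>M. AE p in lborel. p \<in> K \<longrightarrow> \<bar>f p\<bar> \<le> M" by (intro exI[of _ M] AE_I2) auto
qed

lemma continuous_loc_integrable:
  assumes "continuous_on U f"
  shows "loc_integrable U f"
  unfolding loc_integrable_def set_integrable_def
  by (intro allI impI borel_integrable_compact) (use assms continuous_on_subset in blast)+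

text \<open>Intended for the second derivative of \<open>W\<close> in \<open>x\<close>, a continuous
  function cut off at the free boundary.\<close>

lemma loc_ess_bounded_mult_indicator:
  assumes "loc_ess_bounded U f"
  shows "loc_ess_bounded U (\<lambda>p. indicator B p * f p)"
  unfolding loc_ess_bounded_def
proof (intro allI impI)
  fix K assume "compact K \<and> K \<subseteq> U"
  then obtain M where "AE p in lborel. p \<in> K \<longrightarrow> \<bar>f p\<bar> \<le> M"
    using assms by (auto simp: loc_ess_bounded_def)
  hence "AE p in lborel. p \<in> K \<longrightarrow> \<bar>indicator B p * f p\<bar> \<le> \<bar>M\<bar>"
    by eventually_elim (auto simp: indicator_def)
  thus "\<exists>M. AE p in lborel. p \<in> K \<longrightarrow> \<bar>indicator B p * f p\<bar> \<le> M" by blast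
qed

lemma loc_integrable_mult_indicator:
  assumes "loc_integrable U f" "B \<in> sets borel"
  shows "loc_integrable U (\<lambda>p. indicator B p * f p)"
  unfolding loc_integrable_def set_integrable_def
proof (intro allI impI)
  fix K assume "compact K \<and> K \<subseteq> U"
  hence "integrable lborel (\<lambda>p. indicator K p *\<^sub>R f p)"
    using assms(1) by (auto simp: loc_integrable_def set_integrable_def)
  hence "integrable lborel (\<lambda>p. indicator B p *\<^sub>R (indicator K p *\<^sub>R f p))"
    by (rule integrable_mult_indicator[rotated]) (use assms(2) in simp)
  thus "integrable lborel (\<lambda>p. indicator K p *\<^sub>R (indicator B p * f p))"
    by (simp add: mult_ac)
qed

section \<open>The free boundary\<close>

text \<open>Both difference quotients tend to the same \<open>D\<close>, so any switching between
  the branches is harmless. This handles points on the free boundary, in \<open>x\<close> and in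
  \<open>c\<close> alike, whatever the shape of the region \<open>P\<close>.\<close>

lemma has_real_derivative_If:
  fixes f g :: "real \<Rightarrow> real"
  assumes "(f has_real_derivative D) (at c within S)" "(g has_real_derivative D) (at c within S)" "f c = g c"
  shows "((\<lambda>d. if P d then f d else g d) has_real_derivative D) (at c within S)"
proof -
  have "((\<lambda>y. if P y then (f y - f c) / (y - c) else (g y - g c) / (y - c)) \<longlongrightarrow> D) (at c within S)"
    using assms(1,2) unfolding has_field_derivative_iff
    by (intro filterlim_If) (auto elim: filterlim_mono)
  moreover have "(\<lambda>y. if P y then (f y - f c) / (y - c) else (g y - g c) / (y - c))
     = (\<lambda>y. ((if P y then f y else g y) - (if P c then f c else g c)) / (y - c))"
    using assms(3) by auto
  ultimately show ?thesis unfolding has_field_derivative_iff by simp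
qed

lemma strictly_convex_on_imp_convex_on:
  assumes "strictly_convex_on S f"
  shows "convex_on S f"
proof (rule convex_onI)
  fix t x y :: real assume *: "0 < t" "t < 1" "x \<in> S" "y \<in> S"
  show "f ((1 - t) *\<^sub>R x + t *\<^sub>R y) \<le> (1 - t) * f x + t * f y"
  proof (cases "x = y")
    case False
    with * have "f ((1 - t) * x + t * y) < (1 - t) * f x + t * f y"
      using assms unfolding strictly_convex_on_def by blast
    thus ?thesis by simp
  qed (simp add: algebra_simps)
qed (use assms in \<open>simp add: strictly_convex_on_def\<close>)

text \<open>The weak tangent inequality at the midpoint of \<open>c\<close> and \<open>x\<close>,
  combined with strict convexity at that midpoint, becomes strict at \<open>x\<close>.\<close>

lemma strictly_convex_above_tangent:
  assumes "strictly_convex_on UNIV f" "(f has_real_derivative D) (at c)" "x \<noteq> c"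
  shows "f c + D * (x - c) < f x"
proof -
  let ?m = "(1 - 1/2) * c + (1/2) * x"
  have "\<forall>x y t. x \<noteq> y \<and> 0 < t \<and> t < 1 \<longrightarrow> f ((1 - t) * x + t * y) < (1 - t) * f x + t * f y"
    using assms(1) by (simp add: strictly_convex_on_def)
  from this[rule_format, of c x "1/2"] assms(3)
  have "f ?m < (1 - 1/2) * f c + (1/2) * f x" by simp
  moreover have "f ?m - f c \<ge> D * (?m - c)"
    by (rule convex_on_imp_above_tangent[where A = UNIV])
       (use assms strictly_convex_on_imp_convex_on in auto)
  ultimately show ?thesis by (simp add: field_simps)
qed

locale free_boundary =
  fixes th sg mu lam :: real and Phi dPhi :: "real \<Rightarrow> real"
  assumes pos: "th > 0" "sg > 0" "mu > 0" "lam > 0"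
    and Phi_deriv: "\<And>c. (Phi has_real_derivative dPhi c) (at c)"
    and dPhi_cont: "continuous_on UNIV dPhi"
    and Phi_sconv: "strictly_convex_on UNIV Phi"
    and Phi_1: "Phi 1 = 0"
    and k_neg: "\<And>c. c \<in> {0..1} \<Longrightarrow> kfun th lam Phi c < 0"
begin

abbreviation "\<psi> n \<equiv> psi_deriv n th sg mu lam"
abbreviation "k \<equiv> kfun th lam Phi"
abbreviation "\<zeta> \<equiv> zeta th lam Phi"
abbreviation "x0 \<equiv> x0bar th mu lam Phi"
abbreviation "\<gamma> \<equiv> gam th sg mu lam Phi"
abbreviation "W \<equiv> Wfun th sg mu lam Phi"

section \<open>Signs and derivatives of psi, zeta and x0\<close>

lemma \<psi>_pos: "\<psi> n x > 0"
  by (rule psi_deriv_pos[OF pos(1,2,4)])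

lemma \<psi>_deriv:
  "(\<psi> 0 has_real_derivative \<psi> 1 x) (at x)"
  "(\<psi> 1 has_real_derivative \<psi> 2 x) (at x)"
  using psi_deriv_has_derivative[OF pos(1,2,4), of 0] psi_deriv_has_derivative[OF pos(1,2,4), of 1]
  by (simp_all add: numeral_2_eq_2)

lemma \<psi>_cont: "continuous_on S (\<psi> n)"
  using psi_deriv_has_derivative[OF pos(1,2,4)] by (metis DERIV_isCont continuous_at_imp_continuous_on)

lemma psi_eq: "psi th sg mu lam = \<psi> 0" "deriv (psi th sg mu lam) = \<psi> 1"
  using psi_eq_psi_deriv_0[OF pos(1,2)] \<psi>_deriv(1) by (auto intro!: DERIV_imp_deriv)

lemma \<psi>_mono: "x \<le> y \<Longrightarrow> \<psi> n x \<le> \<psi> n y"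
proof (rule DERIV_nonneg_imp_nondecreasing, assumption)
  show "\<exists>d. (\<psi> n has_real_derivative d) (at t) \<and> 0 \<le> d" for t
    using psi_deriv_has_derivative[OF pos(1,2,4), of n mu t] less_imp_le[OF \<psi>_pos[of "Suc n" t]] by blast
qed

lemma k_eq: "k c = lam + th + lam * dPhi c"
  using Phi_deriv by (simp add: kfun_def DERIV_imp_deriv)

lemma Phi_cont: "continuous_on S Phi"
  using Phi_deriv by (metis DERIV_isCont continuous_at_imp_continuous_on)

lemma \<zeta>_deriv: "(\<zeta> has_real_derivative - k c) (at c)"
  unfolding zeta_def[abs_def] k_eq
  by (auto intro!: derivative_eq_intros Phi_deriv)

text \<open>By the mean value theorem: \<open>\<zeta>\<close> vanishes at 1 and has derivative
  \<open>- k\<close>, which is positive on [0,1].\<close>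

lemma \<zeta>_neg:
  assumes "c \<in> {0..<1}"
  shows "\<zeta> c < 0"
proof -
  have "\<exists>z. z > c \<and> z < 1 \<and> \<zeta> 1 - \<zeta> c = (1 - c) * - k z"
    by (rule MVT2) (use assms \<zeta>_deriv in auto)
  then obtain z where "z > c" "z < 1" "\<zeta> 1 - \<zeta> c = (1 - c) * - k z" by blast
  moreover from this assms have "(1 - c) * - k z > 0" using k_neg[of z] by (intro mult_pos_pos) auto
  moreover have "\<zeta> 1 = 0" by (simp add: zeta_def Phi_1)
  ultimately show ?thesis by simp
qed

lemma \<zeta>_cont: "continuous_on S \<zeta>"
  using \<zeta>_deriv by (metis DERIV_isCont continuous_at_imp_continuous_on)

text \<open>Comes from differentiating \<open>\<zeta> c * x0 c = th * mu * Phi c\<close>; in this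
  form \<open>\<zeta> c * dx0 c\<close> can be substituted directly in the boundary
  computation.\<close>

definition "dx0 c = (th * mu * dPhi c + k c * x0 c) / \<zeta> c"

lemma x0_deriv:
  assumes "c \<in> {0..<1}"
  shows "(x0 has_real_derivative dx0 c) (at c)"
  unfolding x0bar_def[abs_def] dx0_def using \<zeta>_neg[OF assms]
  by (auto intro!: derivative_eq_intros Phi_deriv \<zeta>_deriv) (simp add: field_simps power2_eq_square)

text \<open>After the products of \<open>Phi\<close> and \<open>dPhi\<close> cancel, the sign is
  that of \<open>Phi c + dPhi c * (1 - c)\<close>. This is the tangent at \<open>c\<close> evaluated
  at 1, strictly below \<open>Phi 1 = 0\<close>.\<close>

lemma dx0_neg:
  assumes "c \<in> {0..<1}"
  shows "dx0 c < 0"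
proof -
  have "Phi c + dPhi c * (1 - c) < 0"
    using strictly_convex_above_tangent[OF Phi_sconv Phi_deriv[of c], of 1] assms Phi_1 by auto
  moreover have "dx0 c = th * mu * (lam + th) * (Phi c + dPhi c * (1 - c)) / (\<zeta> c)\<^sup>2"
    using \<zeta>_neg[OF assms] unfolding dx0_def k_eq x0bar_def
    by (simp add: field_simps power2_eq_square) (simp add: zeta_def algebra_simps)
  ultimately show ?thesis using pos \<zeta>_neg[OF assms]
    by (simp add: divide_neg_pos mult_pos_neg)
qed

section \<open>The increasing bijection h and the boundary as its inverse composed with x0\<close>

definition "h x = x - \<psi> 0 x / \<psi> 1 x"
definition "dh x = \<psi> 0 x * \<psi> 2 x / (\<psi> 1 x)\<^sup>2"

lemma h_deriv: "(h has_real_derivative dh x) (at x)"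
  unfolding h_def[abs_def] dh_def using \<psi>_pos[of 1 x]
  by (auto intro!: derivative_eq_intros \<psi>_deriv simp del: One_nat_def) (simp add: field_simps power2_eq_square)

lemma dh_ge_1: "dh x \<ge> 1"
  using psi_deriv_log_convex[OF pos(1,2,4), of mu x] \<psi>_pos[of 1 x] by (simp add: dh_def field_simps)

text \<open>Since \<open>dh\<close> is at least 1, \<open>h x - x\<close> is nondecreasing.
  Injectivity, surjectivity and the Lipschitz bound for the inverse all follow from this.\<close>

lemma h_expanding:
  assumes "x \<le> y"
  shows "y - x \<le> h y - h x"
proof -
  have "h x - x \<le> h y - y"
  proof (rule DERIV_nonneg_imp_nondecreasing[OF assms])
    fix t
    show "\<exists>d. ((\<lambda>x. h x - x) has_real_derivative d) (at t) \<and> 0 \<le> d"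
      using dh_ge_1[of t] by (intro exI[of _ "dh t - 1"]) (auto intro!: derivative_eq_intros h_deriv)
  qed
  thus ?thesis by simp
qed

lemma h_eq_iff: "h x = h y \<longleftrightarrow> x = y"
  using h_expanding[of x y] h_expanding[of y x] by force

lemma h_cont: "continuous_on S h"
  using h_deriv by (metis DERIV_isCont continuous_at_imp_continuous_on)

text \<open>Starting at 0, \<open>h\<close> moves at least at unit speed, so at
  \<open>v - h 0\<close> it has reached or passed \<open>v\<close>; the intermediate value theorem
  does the rest.\<close>

lemma h_surj: "\<exists>x. h x = v"
proof (cases "h 0 \<le> v")
  case True
  have "v \<le> h (v - h 0)" using h_expanding[of 0 "v - h 0"] True by simp
  with True show ?thesis using IVT'[of h 0 v "v - h 0"] h_cont by auto
next
  case False
  have "h (v - h 0) \<le> v" using h_expanding[of "v - h 0" 0] False by simp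
  with False show ?thesis using IVT'[of h "v - h 0" v 0] h_cont by auto
qed

lemma boundary_equation_iff: "psi th sg mu lam x / deriv (psi th sg mu lam) x = x - v \<longleftrightarrow> h x = v"
  unfolding psi_eq(2) unfolding psi_eq(1) h_def by auto

lemma boundary_equation_ex1: "\<exists>!x. psi th sg mu lam x / deriv (psi th sg mu lam) x = x - v"
  unfolding boundary_equation_iff using h_surj h_eq_iff by metis

lemma h_\<gamma>: "h (\<gamma> c) = x0 c"
  using theI'[OF boundary_equation_ex1, of "x0 c"] by (simp add: gam_def boundary_equation_iff)

lemma \<gamma>_gt: "\<gamma> c > x0 c"
  using \<psi>_pos[of 0 "\<gamma> c"] \<psi>_pos[of 1 "\<gamma> c"] by (simp add: h_def flip: h_\<gamma>)

definition "dgam c = dx0 c / dh (\<gamma> c)"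

lemma \<gamma>_deriv:
  assumes "c \<in> {0..<1}"
  shows "(\<gamma> has_real_derivative dgam c) (at c)"
proof -
  obtain G where G: "\<And>v. h (G v) = v" using h_surj by metis
  have \<gamma>G: "G (x0 c) = \<gamma> c" for c using h_\<gamma> G h_eq_iff by metis
  \<comment> \<open>Expansion of \<open>h\<close> makes its inverse \<open>G\<close> 1-Lipschitz,
    which supplies the continuity that the inverse function rule asks for.\<close>
  have "\<bar>G v - G w\<bar> \<le> 1 * \<bar>v - w\<bar>" for v w
    using h_expanding[of "G v" "G w"] h_expanding[of "G w" "G v"] by (cases "G v \<le> G w") (auto simp: G)
  hence "isCont G v" for v
    unfolding isCont_def by (intro metric_tendsto_imp_tendsto[OF tendsto_ident_at]) (auto simp: dist_real_def)
  hence "(G has_real_derivative inverse (dh (G (x0 c)))) (at (x0 c))"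
    using dh_ge_1[of "G (x0 c)"] G h_deriv
    by (intro DERIV_inverse_function[where f = h and a = "x0 c - 1" and b = "x0 c + 1"]) auto
  from DERIV_chain2[OF this x0_deriv[OF assms]]
  have "((\<lambda>c. G (x0 c)) has_real_derivative dgam c) (at c)"
    by (simp add: \<gamma>G dgam_def divide_inverse mult.commute)
  thus ?thesis by (simp add: \<gamma>G)
qed

lemma \<gamma>_isCont: "c \<in> {0..<1} \<Longrightarrow> isCont \<gamma> c"
  by (rule DERIV_isCont[OF \<gamma>_deriv])

lemma dgam_neg: "c \<in> {0..<1} \<Longrightarrow> dgam c < 0"
  using dx0_neg dh_ge_1[of "\<gamma> c"] by (simp add: dgam_def divide_neg_pos)

lemma \<gamma>_cont: "continuous_on {0..<1} \<gamma>"
  using \<gamma>_isCont by (simp add: continuous_at_imp_continuous_on)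

lemma \<gamma>_strict_antimono:
  assumes "0 \<le> c1" "c1 < c2" "c2 < 1"
  shows "\<gamma> c2 < \<gamma> c1"
proof (rule DERIV_neg_imp_decreasing[OF assms(2)])
  fix c assume "c1 \<le> c" "c \<le> c2"
  with assms have "c \<in> {0..<1}" by simp
  thus "\<exists>d. (\<gamma> has_real_derivative d) (at c) \<and> d < 0" using \<gamma>_deriv dgam_neg by blast
qed

lemma k_cont: "continuous_on S k"
  unfolding k_eq[abs_def] by (intro continuous_intros continuous_on_subset[OF dPhi_cont]) auto

lemma dgam_cont: "continuous_on {0..<1} dgam"
proof -
  have c: "continuous_on {0..<1} (\<lambda>c. \<psi> n (\<gamma> c))" for n
    by (rule continuous_on_compose2[OF \<psi>_cont[of UNIV] \<gamma>_cont]) auto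
  have x0: "continuous_on {0..<1} x0"
    by (intro continuous_at_imp_continuous_on ballI DERIV_isCont[OF x0_deriv])
  have dPhi: "continuous_on {0..<1} dPhi" by (rule continuous_on_subset[OF dPhi_cont]) simp
  have "\<forall>c\<in>{0..<1}. \<zeta> c \<noteq> 0" using \<zeta>_neg by (metis less_irrefl)
  hence "continuous_on {0..<1} dx0"
    unfolding dx0_def[abs_def]
    by (intro continuous_on_divide continuous_on_add continuous_on_mult continuous_on_const dPhi k_cont x0 \<zeta>_cont)
  moreover have "continuous_on {0..<1} (\<lambda>c. dh (\<gamma> c))"
    unfolding dh_def
    by (intro continuous_on_divide continuous_on_mult continuous_on_power c) (simp add: not_sym[OF less_imp_neq[OF \<psi>_pos]])
  moreover have "\<forall>c\<in>{0..<1}. dh (\<gamma> c) \<noteq> 0" using dh_ge_1 by (metis not_one_le_zero)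
  ultimately show ?thesis unfolding dgam_def[abs_def] by (intro continuous_on_divide)
qed

section \<open>The solution below the boundary and its fit\<close>

text \<open>Below the boundary \<open>W x c\<close> is \<open>V x c = A c \<cdot> \<psi> x\<close> plus the affine particular solution of the
  inhomogeneous equation; this \<open>A\<close> is the only coefficient that makes value and slope fit at \<open>\<gamma> c\<close>.\<close>

definition "A c = \<zeta> c / ((lam + th) * \<psi> 1 (\<gamma> c))"
definition "dA c = (- k c * \<psi> 1 (\<gamma> c) - \<zeta> c * (\<psi> 2 (\<gamma> c) * dgam c)) / ((lam + th) * (\<psi> 1 (\<gamma> c))\<^sup>2)"
definition "V x c = \<psi> 0 x * A c + lam * Phi c * ((x - mu) / (lam + th) + mu / lam)"
definition "Vx x c = \<psi> 1 x * A c + lam * Phi c / (lam + th)"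
definition "Vc x c = \<psi> 0 x * dA c + lam * dPhi c * ((x - mu) / (lam + th) + mu / lam)"
definition "Vcx x c = \<psi> 1 x * dA c + lam * dPhi c / (lam + th)"

lemma A_deriv:
  assumes "c \<in> {0..<1}"
  shows "(A has_real_derivative dA c) (at c)"
proof -
  have "((\<lambda>c. \<psi> 1 (\<gamma> c)) has_real_derivative \<psi> 2 (\<gamma> c) * dgam c) (at c)"
    by (rule DERIV_chain2[OF \<psi>_deriv(2) \<gamma>_deriv[OF assms]])
  hence "((\<lambda>c. (lam + th) * \<psi> 1 (\<gamma> c)) has_real_derivative (lam + th) * (\<psi> 2 (\<gamma> c) * dgam c)) (at c)"
    by (rule DERIV_cmult)
  moreover have nz: "\<psi> 1 (\<gamma> c) \<noteq> 0" "lam + th \<noteq> 0" using \<psi>_pos[of 1 "\<gamma> c"] pos by auto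
  ultimately have "(A has_real_derivative
      (- k c * ((lam + th) * \<psi> 1 (\<gamma> c)) - \<zeta> c * ((lam + th) * (\<psi> 2 (\<gamma> c) * dgam c)))
      / ((lam + th) * \<psi> 1 (\<gamma> c) * ((lam + th) * \<psi> 1 (\<gamma> c)))) (at c)"
    unfolding A_def[abs_def] by (intro DERIV_divide \<zeta>_deriv) auto
  also have "(- k c * ((lam + th) * \<psi> 1 (\<gamma> c)) - \<zeta> c * ((lam + th) * (\<psi> 2 (\<gamma> c) * dgam c)))
      / ((lam + th) * \<psi> 1 (\<gamma> c) * ((lam + th) * \<psi> 1 (\<gamma> c)))
    = ((lam + th) * (- k c * \<psi> 1 (\<gamma> c) - \<zeta> c * (\<psi> 2 (\<gamma> c) * dgam c)))
      / ((lam + th) * ((lam + th) * (\<psi> 1 (\<gamma> c))\<^sup>2))"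
    by (simp add: power2_eq_square right_diff_distrib mult_ac)
  also have "\<dots> = dA c" unfolding dA_def by (rule mult_divide_mult_cancel_left[OF nz(2)])
  finally show ?thesis .
qed

lemma V_deriv_c: "c \<in> {0..<1} \<Longrightarrow> (V x has_real_derivative Vc x c) (at c)"
  unfolding V_def[abs_def] Vc_def
  by (auto intro!: derivative_eq_intros A_deriv Phi_deriv)

lemma V_deriv_x:
  "((\<lambda>x. V x c) has_real_derivative Vx x c) (at x)"
  "((\<lambda>x. Vx x c) has_real_derivative \<psi> 2 x * A c) (at x)"
  "((\<lambda>x. Vc x c) has_real_derivative Vcx x c) (at x)"
  unfolding V_def[abs_def] Vx_def[abs_def] Vc_def[abs_def] Vcx_def
  using pos by (auto intro!: derivative_eq_intros \<psi>_deriv simp del: One_nat_def)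

text \<open>The \<open>\<psi>\<close> part satisfies the homogeneous equation; what remains is an
  affine function of \<open>x\<close>, whose second derivative is zero.\<close>

lemma V_ode: "1/2 * sg\<^sup>2 * (\<psi> 2 x * A c) + th * (mu - x) * Vx x c - lam * V x c = - lam * x * Phi c"
proof -
  have "1/2 * sg\<^sup>2 * (\<psi> 2 x * A c) + th * (mu - x) * (\<psi> 1 x * A c)
      = (1/2 * sg\<^sup>2 * \<psi> 2 x + th * (mu - x) * \<psi> 1 x) * A c" by (simp add: algebra_simps)
  also have "\<dots> = lam * \<psi> 0 x * A c" using psi_deriv_ode[OF pos(1,2,4)] by simp
  finally have "1/2 * sg\<^sup>2 * (\<psi> 2 x * A c) + th * (mu - x) * Vx x c - lam * V x c
      = th * (mu - x) * (lam * Phi c / (lam + th)) - lam * (lam * Phi c * ((x - mu) / (lam + th) + mu / lam))"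
    by (simp add: V_def Vx_def algebra_simps)
  also have "\<dots> = - lam * x * Phi c"
    using pos by (simp add: divide_simps) (simp add: algebra_simps)
  finally show ?thesis .
qed

lemma \<gamma>_minus_x0: "\<gamma> c - x0 c = \<psi> 0 (\<gamma> c) / \<psi> 1 (\<gamma> c)"
  using h_\<gamma>[of c] by (simp add: h_def)

text \<open>Both functions of \<open>x\<close> are affine: \<open>x0 c\<close> is where payoff and
  particular solution cross, and \<open>\<zeta> c / (lam + th)\<close> is the difference of their
  slopes.\<close>

lemma stopping_payoff_minus_particular:
  assumes "c \<in> {0..<1}"
  shows "x * (1 - c) - lam * Phi c * ((x - mu) / (lam + th) + mu / lam) = \<zeta> c * (x - x0 c) / (lam + th)"
proof -
  have "\<zeta> c * x0 c = th * mu * Phi c" using \<zeta>_neg[OF assms] by (simp add: x0bar_def)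
  hence "\<zeta> c * (x - x0 c) = \<zeta> c * x - th * mu * Phi c" by (simp add: algebra_simps)
  thus ?thesis using pos
    by (simp add: divide_simps) (simp add: zeta_def algebra_simps)
qed

text \<open>The last two facts reflect differentiation along the boundary. From
  \<open>V (\<gamma> c) c = \<gamma> c * (1 - c)\<close> and the slope fit one gets
  \<open>Vc = - \<gamma> c\<close>; from \<open>Vx (\<gamma> c) c = 1 - c\<close> one gets
  \<open>Vcx = - 1 - \<psi> 2 (\<gamma> c) * A c * dgam c\<close>, where \<open>A c\<close> and
  \<open>dgam c\<close> are both negative. The proof checks these by explicit computation.\<close>

lemma V_\<gamma>:
  assumes "c \<in> {0..<1}"
  shows "\<gamma> c * (1 - c) - lam * Phi c * ((\<gamma> c - mu) / (lam + th) + mu / lam) = \<psi> 0 (\<gamma> c) * A c"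
    and "V (\<gamma> c) c = \<gamma> c * (1 - c)"
    and "Vx (\<gamma> c) c = 1 - c"
    and "Vc (\<gamma> c) c = - \<gamma> c"
    and "Vcx (\<gamma> c) c < - 1"
proof -
  let ?g = "\<gamma> c"
  have p: "\<psi> 0 ?g > 0" "\<psi> 1 ?g > 0" "\<psi> 2 ?g > 0" by (rule \<psi>_pos)+
  have l: "lam + th > 0" using pos by simp
  show *: "?g * (1 - c) - lam * Phi c * ((?g - mu) / (lam + th) + mu / lam) = \<psi> 0 ?g * A c"
    unfolding stopping_payoff_minus_particular[OF assms] \<gamma>_minus_x0 A_def by (simp add: mult.commute)
  thus "V ?g c = ?g * (1 - c)" by (simp add: V_def)
  have "Vx ?g c = (\<zeta> c + lam * Phi c) / (lam + th)"
    using p by (simp add: Vx_def A_def add_divide_distrib)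
  also have "\<dots> = 1 - c" using l by (simp add: zeta_def)
  finally show "Vx ?g c = 1 - c" .
  have "\<psi> 0 ?g * dA c = (- k c * (\<psi> 0 ?g / \<psi> 1 ?g) - \<zeta> c * dx0 c) / (lam + th)"
  proof -
    \<comment> \<open>Here \<open>p\<close>, \<open>q\<close>, \<open>r\<close> stand for
      \<open>\<psi> 0\<close>, \<open>\<psi> 1\<close>, \<open>\<psi> 2\<close> at the boundary and
      \<open>d\<close> for \<open>dx0 c\<close>. The second derivative \<open>r\<close> cancels
      against the one in \<open>dh\<close>.\<close>
    have alg: "p * ((- a * q - z * (r * (d / (p * r / q\<^sup>2)))) / (m * q\<^sup>2)) = (- a * (p / q) - z * d) / m"
      if "p > 0" "q > 0" "r > 0" "m > 0" for p q r m a z d :: real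
      using that by (simp add: field_simps power2_eq_square)
    show ?thesis unfolding dA_def dgam_def dh_def by (rule alg[OF p(1,2,3) l])
  qed
  also have "\<zeta> c * dx0 c = th * mu * dPhi c + k c * x0 c"
    using \<zeta>_neg[OF assms] by (simp add: dx0_def)
  also have "\<psi> 0 ?g / \<psi> 1 ?g = ?g - x0 c" by (simp add: \<gamma>_minus_x0)
  finally have "\<psi> 0 ?g * dA c = (- k c * ?g - th * mu * dPhi c) / (lam + th)" by (simp add: algebra_simps)
  hence "Vc ?g c = (- k c * ?g - th * mu * dPhi c) / (lam + th) + lam * dPhi c * ((?g - mu) / (lam + th) + mu / lam)"
    by (simp add: Vc_def)
  also have "\<dots> = - ?g"
    using pos unfolding k_eq by (simp add: divide_simps) (simp add: algebra_simps)
  finally show "Vc ?g c = - ?g" .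
  have "Vcx ?g c = - 1 - \<zeta> c * dgam c * (\<psi> 2 ?g / (\<psi> 1 ?g * (lam + th)))"
  proof -
    have alg: "q * ((- (m + a) * q - z * (r * d)) / (m * q\<^sup>2)) + a / m = - 1 - z * d * (r / (q * m))"
      if "q > 0" "m > 0" for q r m a z d :: real
      using that by (simp add: field_simps power2_eq_square)
    show ?thesis unfolding Vcx_def dA_def k_eq by (rule alg[OF p(2) l])
  qed
  moreover have "\<zeta> c * dgam c * (\<psi> 2 ?g / (\<psi> 1 ?g * (lam + th))) > 0"
    using \<zeta>_neg[OF assms] dgam_neg[OF assms] p l by (intro mult_pos_pos mult_neg_neg divide_pos_pos)
  ultimately show "Vcx ?g c < - 1" by simp
qed

section \<open>Classical derivatives of W\<close>

lemma W_eq: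
  assumes "c \<in> {0..<1}"
  shows "W x c = (if x < \<gamma> c then V x c else x * (1 - c))"
  \<comment> \<open>The bracket in \<open>Wfun\<close> equals
    \<open>\<psi> 0 (\<gamma> c) * A c\<close>, so its division by
    \<open>\<psi> 0 (\<gamma> c)\<close> leaves the coefficient \<open>A c\<close>.\<close>
  using assms \<psi>_pos[of 0 "\<gamma> c"] V_\<gamma>(1)[OF assms] by (simp add: Wfun_def Let_def psi_eq V_def)

definition "Wx x c = (if x < \<gamma> c then Vx x c else 1 - c)"
definition "Wc x c = (if x < \<gamma> c then Vc x c else - x)"

lemma W_deriv_x:
  assumes c: "c \<in> {0..<1}"
  shows "((\<lambda>x. W x c) has_real_derivative Wx x c) (at x)"
proof -
  have eq: "(\<lambda>x. W x c) = (\<lambda>x. if x < \<gamma> c then V x c else x * (1 - c))" using W_eq[OF c] by auto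
  have d: "((\<lambda>x. x * (1 - c)) has_real_derivative 1 - c) (at x)" by (auto intro!: derivative_eq_intros)
  consider "x < \<gamma> c" | "x = \<gamma> c" | "x > \<gamma> c" by linarith
  thus ?thesis
  proof cases
    case 1
    show ?thesis
      by (rule has_field_derivative_transform_within_open[where f = "\<lambda>x. V x c" and S = "{..<\<gamma> c}"])
         (use 1 V_deriv_x(1) in \<open>auto simp: W_eq[OF c] Wx_def\<close>)
  next
    case 2
    show ?thesis unfolding eq
      by (rule has_real_derivative_If) (use 2 V_deriv_x(1)[of c x] d V_\<gamma>[OF c] in \<open>auto simp: Wx_def\<close>)
  next
    case 3
    show ?thesis
      by (rule has_field_derivative_transform_within_open[where f = "\<lambda>x. x * (1 - c)" and S = "{\<gamma> c<..}"])
         (use 3 d in \<open>auto simp: W_eq[OF c] Wx_def\<close>)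
  qed
qed

text \<open>The boundary point is excluded because for \<open>c\<close> in [0,1) the second
  derivative jumps there, from the negative value \<open>\<psi> 2 x * A c\<close> to 0.\<close>

lemma Wx_deriv_x:
  assumes "x \<noteq> \<gamma> c"
  shows "((\<lambda>x. Wx x c) has_real_derivative (if x < \<gamma> c then \<psi> 2 x * A c else 0)) (at x)"
proof (cases "x < \<gamma> c")
  case True
  show ?thesis
    by (rule has_field_derivative_transform_within_open[where f = "\<lambda>x. Vx x c" and S = "{..<\<gamma> c}"])
       (use True V_deriv_x(2) in \<open>auto simp: Wx_def\<close>)
next
  case False
  with assms have *: "x > \<gamma> c" by simp
  show ?thesis
    by (rule has_field_derivative_transform_within_open[where f = "\<lambda>x. 1 - c" and S = "{\<gamma> c<..}"])
       (use * in \<open>auto simp: Wx_def\<close>)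
qed

text \<open>Off the boundary, continuity of \<open>\<gamma>\<close> keeps nearby \<open>d\<close> on
  the same branch; on it the two branches agree in value and \<open>c\<close>-derivative.
  Differentiating within \<open>{0..<1}\<close> covers \<open>c = 0\<close> as a one-sided
  derivative.\<close>

lemma W_deriv_c:
  assumes c: "c \<in> {0..<1}"
  shows "(W x has_real_derivative Wc x c) (at c within {0..<1})"
proof -
  have d: "((\<lambda>c. x * (1 - c)) has_real_derivative - x) (at c within {0..<1})" by (auto intro!: derivative_eq_intros)
  have V: "(V x has_real_derivative Vc x c) (at c within {0..<1})"
    by (rule has_field_derivative_at_within[OF V_deriv_c[OF c]])
  have ev: "\<forall>\<^sub>F d in at c within {0..<1}. W x d = (if x < \<gamma> d then V x d else x * (1 - d))"
    using W_eq by (auto simp: eventually_at_filter)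
  have lim: "(\<gamma> \<longlongrightarrow> \<gamma> c) (at c within {0..<1})"
    using \<gamma>_isCont[OF c] unfolding isCont_def by (rule tendsto_within_subset) simp
  consider "x < \<gamma> c" | "x = \<gamma> c" | "x > \<gamma> c" by linarith
  thus ?thesis
  proof cases
    case 1
    have "\<forall>\<^sub>F d in at c within {0..<1}. W x d = V x d"
      using ev order_tendstoD(1)[OF lim 1] by eventually_elim simp
    thus ?thesis using V 1 by (subst has_field_derivative_cong_eventually) (auto simp: W_eq[OF c] Wc_def)
  next
    case 2
    have "((\<lambda>d. if x < \<gamma> d then V x d else x * (1 - d)) has_real_derivative Wc x c) (at c within {0..<1})"
      by (rule has_real_derivative_If) (use 2 V d V_\<gamma>[OF c] in \<open>auto simp: Wc_def\<close>)
    thus ?thesis by (subst has_field_derivative_cong_eventually[OF ev]) (auto simp: W_eq[OF c])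
  next
    case 3
    have "\<forall>\<^sub>F d in at c within {0..<1}. W x d = x * (1 - d)"
      using ev order_tendstoD(2)[OF lim 3] by eventually_elim simp
    thus ?thesis using d 3 by (subst has_field_derivative_cong_eventually) (auto simp: W_eq[OF c] Wc_def)
  qed
qed

text \<open>\<open>W\<^sub>c + x\<close> vanishes at the boundary. Its slope \<open>Vcx + 1 = \<psi>' dA + k / (lam + th)\<close> is negative to the
  left of it: for \<open>dA \<le> 0\<close> because \<open>k < 0\<close>, otherwise because it is increasing in \<open>x\<close>.\<close>

lemma Vcx_less_neg_1:
  assumes c: "c \<in> {0..<1}" and x: "x \<le> \<gamma> c"
  shows "Vcx x c < - 1"
proof (cases "dA c \<le> 0")
  case True
  have "Vcx x c + 1 = \<psi> 1 x * dA c + k c / (lam + th)"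
    using pos by (simp add: Vcx_def k_eq field_simps)
  moreover have "\<psi> 1 x * dA c \<le> 0" using True \<psi>_pos[of 1 x] by (simp add: mult_nonneg_nonpos)
  moreover have "k c / (lam + th) < 0" using k_neg[of c] c pos by (simp add: divide_neg_pos)
  ultimately show ?thesis by simp
next
  case False
  hence "Vcx x c \<le> Vcx (\<gamma> c) c" unfolding Vcx_def using \<psi>_mono[OF x, of 1] by simp
  with V_\<gamma>(5)[OF c] show ?thesis by simp
qed

lemma Wc_ge:
  assumes c: "c \<in> {0..<1}"
  shows "Wc x c \<ge> - x"
proof (cases "x < \<gamma> c")
  case True
  have "Vc (\<gamma> c) c + \<gamma> c \<le> Vc x c + x"
  proof (rule DERIV_nonpos_imp_nonincreasing[of x "\<gamma> c"])
    fix t assume "x \<le> t" "t \<le> \<gamma> c"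
    thus "\<exists>d. ((\<lambda>x. Vc x c + x) has_real_derivative d) (at t) \<and> d \<le> 0"
      using Vcx_less_neg_1[OF c, of t]
      by (intro exI[of _ "Vcx t c + 1"]) (auto intro!: derivative_eq_intros V_deriv_x(3))
  qed (use True in simp)
  with True V_\<gamma>(4)[OF c] show ?thesis by (simp add: Wc_def)
qed (simp add: Wc_def)

section \<open>Joint continuity and Sobolev regularity\<close>

text \<open>The clipped variable \<open>min x (\<gamma> c)\<close> turns the piecewise formulas into compositions of continuous
  functions, by the fits at the boundary.\<close>

lemma clipped:
  assumes "c \<in> {0..<1}"
  shows "W x c = V (min x (\<gamma> c)) c + (x - min x (\<gamma> c)) * (1 - c)"
    and "Wx x c = Vx (min x (\<gamma> c)) c"
    and "Wc x c = Vc (min x (\<gamma> c)) c - (x - min x (\<gamma> c))"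
  using V_\<gamma>[OF assms] by (auto simp: W_eq[OF assms] Wx_def Wc_def min_def algebra_simps)

abbreviation "U \<equiv> UNIV \<times> {0<..<1::real} :: (real \<times> real) set"

lemma continuous_on_strip:
  shows "continuous_on U (\<lambda>p. \<gamma> (snd p))" "continuous_on U (\<lambda>p. A (snd p))" "continuous_on U (\<lambda>p. dA (snd p))"
    "continuous_on U (\<lambda>p. W (fst p) (snd p))" "continuous_on U (\<lambda>p. Wx (fst p) (snd p))"
    "continuous_on U (\<lambda>p. Wc (fst p) (snd p))"
proof -
  have snd: "continuous_on U (\<lambda>p. f (snd p))" if "continuous_on {0..<1} f" for f :: "real \<Rightarrow> real"
    by (rule continuous_on_compose2[OF that]) (auto intro!: continuous_intros)
  have c: "continuous_on {0..<1} (\<lambda>c. \<psi> n (\<gamma> c))" for n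
    by (rule continuous_on_compose2[OF \<psi>_cont[of UNIV] \<gamma>_cont]) auto
  have nz: "\<psi> n x \<noteq> 0" "lam + th \<noteq> 0" for n x using \<psi>_pos[of n x] pos by auto
  have "continuous_on {0..<1} dA"
    unfolding dA_def[abs_def] by (intro continuous_intros c k_cont \<zeta>_cont dgam_cont) (auto simp: nz)
  thus dA: "continuous_on U (\<lambda>p. dA (snd p))" by (rule snd)
  have "continuous_on {0..<1} A"
    unfolding A_def[abs_def] by (intro continuous_intros c \<zeta>_cont) (auto simp: nz)
  thus A: "continuous_on U (\<lambda>p. A (snd p))" by (rule snd)
  show \<gamma>: "continuous_on U (\<lambda>p. \<gamma> (snd p))" by (rule snd[OF \<gamma>_cont])
  have m: "continuous_on U (\<lambda>p. min (fst p) (\<gamma> (snd p)))" by (intro continuous_intros \<gamma>)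
  have \<psi>: "continuous_on U (\<lambda>p. \<psi> n (min (fst p) (\<gamma> (snd p))))" for n
    by (rule continuous_on_compose2[OF \<psi>_cont[of UNIV] m]) auto
  have P: "continuous_on U (\<lambda>p. Phi (snd p))" "continuous_on U (\<lambda>p. dPhi (snd p))"
    by (intro snd Phi_cont continuous_on_subset[OF dPhi_cont] subset_UNIV)+
  have "continuous_on U (\<lambda>p. V (min (fst p) (\<gamma> (snd p))) (snd p) + (fst p - min (fst p) (\<gamma> (snd p))) * (1 - snd p))"
    unfolding V_def using pos by (intro continuous_intros A m \<psi> P \<gamma>) auto
  thus "continuous_on U (\<lambda>p. W (fst p) (snd p))"
    by (rule continuous_on_eq) (auto simp: clipped)
  have "continuous_on U (\<lambda>p. Vx (min (fst p) (\<gamma> (snd p))) (snd p))"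
    unfolding Vx_def using pos by (intro continuous_intros A m \<psi> P \<gamma>) auto
  thus "continuous_on U (\<lambda>p. Wx (fst p) (snd p))"
    by (rule continuous_on_eq) (auto simp: clipped)
  have "continuous_on U (\<lambda>p. Vc (min (fst p) (\<gamma> (snd p))) (snd p) - (fst p - min (fst p) (\<gamma> (snd p))))"
    unfolding Vc_def using pos by (intro continuous_intros dA m \<psi> P \<gamma>) auto
  thus "continuous_on U (\<lambda>p. Wc (fst p) (snd p))"
    by (rule continuous_on_eq) (auto simp: clipped)
qed

text \<open>\<open>Wx\<close> and \<open>Wc\<close> are continuous on the strip. The second
  derivative jumps across the boundary curve but stays bounded on compact sets, as a cut-off
  continuous function.\<close>

lemma W_sobolev: "W21inf_loc U (\<lambda>(x, c). W x c)"
proof -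
  let ?W = "\<lambda>p. W (fst p) (snd p)" and ?Wx = "\<lambda>p. Wx (fst p) (snd p)" and ?Wc = "\<lambda>p. Wc (fst p) (snd p)"
  let ?C = "{p \<in> U. fst p < \<gamma> (snd p)}"
  let ?Wxx = "\<lambda>p. indicator ?C p * (\<psi> 2 (fst p) * A (snd p))"
  note cont = continuous_on_strip
  have "open U" by (intro open_Times) auto
  hence "open ((\<lambda>p. \<gamma> (snd p) - fst p) -` {0<..} \<inter> U)"
    by (subst continuous_on_open_vimage[THEN iffD1]) (auto intro!: continuous_intros cont)
  \<comment> \<open>The continuation region is thus a preimage of an open set under a continuous
    map, hence open and Borel.\<close>
  moreover have "(\<lambda>p. \<gamma> (snd p) - fst p) -` {0<..} \<inter> U = ?C" by auto
  ultimately have "?C \<in> sets borel" by (metis borel_open)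
  have c2: "continuous_on U (\<lambda>p. \<psi> 2 (fst p) * A (snd p))"
    by (intro continuous_intros cont continuous_on_compose2[OF \<psi>_cont[of UNIV]]) auto
  have int: "loc_integrable U ?W" "loc_integrable U ?Wx" "loc_integrable U ?Wc" "loc_integrable U ?Wxx"
    by (intro continuous_loc_integrable loc_integrable_mult_indicator cont c2 \<open>?C \<in> _\<close>)+
  have bdd: "loc_ess_bounded U ?W" "loc_ess_bounded U ?Wx" "loc_ess_bounded U ?Wc" "loc_ess_bounded U ?Wxx"
    by (intro continuous_loc_ess_bounded loc_ess_bounded_mult_indicator cont c2)+
  have wx: "weak_dx U ?W ?Wx"
    by (rule weak_dxI[where S = "\<lambda>_. {}"]) (use int in \<open>auto intro!: W_deriv_x DERIV_isCont\<close>)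
  have wxx: "weak_dx U ?Wx ?Wxx"
  \<comment> \<open>Each horizontal line meets the boundary curve in one point, where
    \<open>Wx\<close> is continuous but not smooth.\<close>
  proof (rule weak_dxI[where S = "\<lambda>c. {\<gamma> c}"])
    fix x c assume p: "(x, c) \<in> U"
    have "continuous_on UNIV (\<lambda>y. Wx y c)"
      by (rule continuous_on_compose2[OF cont(5), of _ "\<lambda>y. (y, c)", simplified])
        (use p in \<open>auto intro!: continuous_intros\<close>)
    thus "isCont (\<lambda>y. ?Wx (y, c)) x" by (simp add: continuous_on_eq_continuous_at)
    show "((\<lambda>y. ?Wx (y, c)) has_real_derivative ?Wxx (x, c)) (at x)" if "x \<notin> {\<gamma> c}"
      using Wx_deriv_x[of x c] that p by (auto simp: indicator_def split: if_splits)
  qed (use int in auto)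
  have wc: "weak_dc U ?W ?Wc"
  proof (rule weak_dcI[where S = "\<lambda>_. {}"])
    fix x c assume p: "(x, c) \<in> U"
    hence "at c within {0..<1} = at c" by (intro at_within_interior) auto
    thus *: "((\<lambda>d. ?W (x, d)) has_real_derivative ?Wc (x, c)) (at c)"
      using W_deriv_c[of c x] p by simp
    show "isCont (\<lambda>d. ?W (x, d)) c" by (rule DERIV_isCont[OF *])
  qed (use int in auto)
  show ?thesis
    unfolding W21inf_loc_def case_prod_unfold using int bdd wx weak_dxxI[OF wx wxx] wc by blast
qed

section \<open>The kink of the c-derivative and the equation in the continuation region\<close>

lemma W_c_vector_derivative:
  assumes c: "c \<in> {0..<1}"
  shows "vector_derivative (W x) (at c within {0..<1}) = Wc x c"
proof (rule vector_derivative_within)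
  \<comment> \<open>Approaching from the right also works at \<open>c = 0\<close>; being a limit
    point makes the derivative within \<open>{0..<1}\<close> unique.\<close>
  have "c islimpt {c<..<1}" using c by (intro islimpt_greaterThanLessThan1) auto
  hence "c islimpt {0..<1}" by (rule islimpt_subset) (use c in auto)
  thus "at c within {0..<1} \<noteq> bot" by (simp add: trivial_limit_within)
  show "(W x has_vector_derivative Wc x c) (at c within {0..<1})"
    using W_deriv_c[OF c] by (simp add: has_real_derivative_iff_has_vector_derivative)
qed

text \<open>The one-sided derivatives at the boundary are \<open>Vcx (\<gamma> c) c\<close> on the
  left and -1 on the right, and the former is strictly smaller.\<close>

lemma Wc_kink:
  assumes c: "c \<in> {0..<1}"
  shows "x < \<gamma> c \<Longrightarrow> ((\<lambda>y. Wc y c) has_real_derivative Vcx x c) (at x)"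
    and "x > \<gamma> c \<Longrightarrow> ((\<lambda>y. Wc y c) has_real_derivative - 1) (at x)"
    and "(deriv (\<lambda>y. Wc y c) \<longlongrightarrow> Vcx (\<gamma> c) c) (at_left (\<gamma> c))"
    and "\<not> (\<lambda>y. Wc y c) differentiable (at (\<gamma> c))"
proof -
  show L: "((\<lambda>y. Wc y c) has_real_derivative Vcx x c) (at x)" if "x < \<gamma> c" for x
    by (rule has_field_derivative_transform_within_open[where f = "\<lambda>x. Vc x c" and S = "{..<\<gamma> c}"])
       (use that V_deriv_x(3) in \<open>auto simp: Wc_def\<close>)
  have m: "((\<lambda>y. - y) has_real_derivative - 1) (at x within S)" for x :: real and S
    by (auto intro!: derivative_eq_intros)
  show "((\<lambda>y. Wc y c) has_real_derivative - 1) (at x)" if "x > \<gamma> c"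
    by (rule has_field_derivative_transform_within_open[where f = "\<lambda>x. - x" and S = "{\<gamma> c<..}"])
       (use that m[of _ UNIV] in \<open>auto simp: Wc_def\<close>)
  have "isCont (\<lambda>x. Vcx x c) (\<gamma> c)"
    unfolding Vcx_def using \<psi>_deriv(2)[THEN DERIV_isCont] pos by (intro continuous_intros) auto
  hence "((\<lambda>x. Vcx x c) \<longlongrightarrow> Vcx (\<gamma> c) c) (at_left (\<gamma> c))"
    by (simp add: isCont_def filterlim_at_split)
  moreover have "\<forall>\<^sub>F x in at_left (\<gamma> c). Vcx x c = deriv (\<lambda>y. Wc y c) x"
  proof -
    have "\<forall>\<^sub>F x in at_left (\<gamma> c). x < \<gamma> c" by (simp add: eventually_at_filter)
    thus ?thesis by eventually_elim (simp add: DERIV_imp_deriv[OF L])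
  qed
  ultimately show "(deriv (\<lambda>y. Wc y c) \<longlongrightarrow> Vcx (\<gamma> c) c) (at_left (\<gamma> c))"
    by (rule Lim_transform_eventually)
  show "\<not> (\<lambda>y. Wc y c) differentiable (at (\<gamma> c))"
  proof
    assume "(\<lambda>y. Wc y c) differentiable (at (\<gamma> c))"
    then obtain D where "((\<lambda>y. Wc y c) has_real_derivative D) (at (\<gamma> c))"
      by (auto simp: real_differentiable_def)
    hence D: "((\<lambda>y. Wc y c) has_real_derivative D) (at (\<gamma> c) within S)" for S
      by (rule has_field_derivative_at_within)
    have "((\<lambda>y. Wc y c) has_real_derivative - 1) (at_right (\<gamma> c))"
      by (subst has_field_derivative_cong_eventually[where g = "\<lambda>y. - y"])
         (auto simp: Wc_def eventually_at_filter m)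
    with D[of "{\<gamma> c<..}"] have "D = - 1"
      by (intro vector_derivative_unique_within[of "\<gamma> c" "{\<gamma> c<..}" "\<lambda>y. Wc y c"])
         (simp_all add: has_real_derivative_iff_has_vector_derivative)
    \<comment> \<open>At \<open>\<gamma> c\<close> itself \<open>Wc\<close> takes the right-hand
      branch; the left branch has the same value there, so it may replace \<open>Wc\<close> in the
      left difference quotient.\<close>
    moreover have "((\<lambda>y. Wc y c) has_real_derivative Vcx (\<gamma> c) c) (at_left (\<gamma> c))"
      using V_\<gamma>(4)[OF c] has_field_derivative_at_within[OF V_deriv_x(3)]
      by (subst has_field_derivative_cong_eventually[where g = "\<lambda>y. Vc y c"])
         (auto simp: Wc_def eventually_at_filter)
    with D[of "{..<\<gamma> c}"] have "D = Vcx (\<gamma> c) c"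
      by (intro vector_derivative_unique_within[of "\<gamma> c" "{..<\<gamma> c}" "\<lambda>y. Wc y c"])
         (simp_all add: has_real_derivative_iff_has_vector_derivative)
    ultimately show False using V_\<gamma>(5)[OF c] by simp
  qed
qed

lemma W_continuation_ode:
  assumes c: "c \<in> {0..<1}" and x: "x < \<gamma> c"
  shows "(\<lambda>y. W y c) differentiable (at x)" "deriv (\<lambda>y. W y c) differentiable (at x)"
    "1/2 * sg\<^sup>2 * deriv (deriv (\<lambda>y. W y c)) x + th * (mu - x) * deriv (\<lambda>y. W y c) x - lam * W x c
      = - lam * x * Phi c"
proof -
  have d: "deriv (\<lambda>y. W y c) = (\<lambda>y. Wx y c)"
    using DERIV_imp_deriv[OF W_deriv_x[OF c]] by auto
  have dd: "((\<lambda>y. Wx y c) has_real_derivative \<psi> 2 x * A c) (at x)"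
    using Wx_deriv_x[of x c] x by simp
  show "(\<lambda>y. W y c) differentiable (at x)" using W_deriv_x[OF c] real_differentiable_def by blast
  show "deriv (\<lambda>y. W y c) differentiable (at x)" using dd real_differentiable_def unfolding d by blast
  show "1/2 * sg\<^sup>2 * deriv (deriv (\<lambda>y. W y c)) x + th * (mu - x) * deriv (\<lambda>y. W y c) x - lam * W x c
      = - lam * x * Phi c"
    unfolding d DERIV_imp_deriv[OF dd] using V_ode[of x c] x by (simp add: W_eq[OF c] Wx_def)
qed

end

theorem mainTheorem10:
  fixes th sg mu lam :: real and Phi :: "real \<Rightarrow> real"
  assumes pos: "th > 0" "sg > 0" "mu > 0" "lam > 0"
    and Phi_C2: "\<forall>x. Phi differentiable (at x)" "\<forall>x. deriv Phi differentiable (at x)"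
                "continuous_on UNIV (deriv (deriv Phi))"
    and Phi_noninc: "antimono Phi"
    and Phi_sconv: "strictly_convex_on UNIV Phi"
    and Phi1: "Phi 1 = 0"
    and k_neg: "\<forall>c\<in>{0..1}. kfun th lam Phi c < 0"
  defines "\<psi> \<equiv> psi th sg mu lam"
    and "x0 \<equiv> x0bar th mu lam Phi"
    and "\<gamma> \<equiv> gam th sg mu lam Phi"
    and "W \<equiv> Wfun th sg mu lam Phi"
    and "Wc \<equiv> (\<lambda>x c. vector_derivative (\<lambda>d. Wfun th sg mu lam Phi x d) (at c within {0..<1}))"
  shows
    \<comment> \<open>unique solvability of the free-boundary equation, location of gamma\<close>
    "(\<forall>c\<in>{0..<1}. (\<exists>!x. \<psi> x / deriv \<psi> x = x - x0 c) \<and> \<gamma> c > x0 c)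
     \<comment> \<open>gamma decreasing and C^1 on [0,1)\<close>
     \<and> (\<forall>c1 c2. 0 \<le> c1 \<and> c1 < c2 \<and> c2 < 1 \<longrightarrow> \<gamma> c2 < \<gamma> c1)
     \<and> (\<exists>D. continuous_on {0..<1} D \<and>
           (\<forall>c\<in>{0..<1}. (\<gamma> has_real_derivative D c) (at c within {0..<1})))
     \<comment> \<open>Sobolev regularity\<close>
     \<and> W21inf_loc (UNIV \<times> {0<..<1}) (\<lambda>(x, c). W x c)
     \<comment> \<open>ODE in the continuation region\<close>
     \<and> (\<forall>c\<in>{0..<1}. \<forall>x. x < \<gamma> c \<longrightarrow>
          (\<lambda>y. W y c) differentiable (at x)
          \<and> deriv (\<lambda>y. W y c) differentiable (at x)
          \<and> 1/2 * sg\<^sup>2 * deriv (deriv (\<lambda>y. W y c)) x + th * (mu - x) * deriv (\<lambda>y. W y c) x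
              - lam * W x c = - lam * x * Phi c)
     \<comment> \<open>W_c >= -x\<close>
     \<and> (\<forall>x. \<forall>c\<in>{0..<1}. \<exists>w. ((\<lambda>d. W x d) has_real_derivative w) (at c within {0..<1}) \<and> w \<ge> - x)
     \<comment> \<open>stopping region\<close>
     \<and> (\<forall>c\<in>{0..<1}. \<forall>x. x \<ge> \<gamma> c \<longrightarrow> W x c = x * (1 - c))
     \<comment> \<open>smooth fit\<close>
     \<and> (\<forall>c\<in>{0..<1}. ((\<lambda>y. W y c) has_real_derivative (1 - c)) (at (\<gamma> c)))
     \<comment> \<open>W_c at the boundary\<close>
     \<and> (\<forall>c\<in>{0..<1}. ((\<lambda>d. W (\<gamma> c) d) has_real_derivative (- \<gamma> c)) (at c within {0..<1}))
     \<comment> \<open>W_cx: left limit below -1, equal to -1 to the right, hence W_c not C^1 across gamma\<close>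
     \<and> (\<forall>c\<in>{0..<1}.
          (\<forall>x. x < \<gamma> c \<longrightarrow> (\<lambda>y. Wc y c) differentiable (at x))
          \<and> (\<exists>L. L < -1 \<and> (deriv (\<lambda>y. Wc y c) \<longlongrightarrow> L) (at_left (\<gamma> c)))
          \<and> (\<forall>x. x > \<gamma> c \<longrightarrow> ((\<lambda>y. Wc y c) has_real_derivative (-1)) (at x))
          \<and> \<not> ((\<lambda>y. Wc y c) differentiable (at (\<gamma> c))))"
proof -
  interpret fb: free_boundary th sg mu lam Phi "deriv Phi"
  proof
    show "(Phi has_real_derivative deriv Phi c) (at c)" for c
      using Phi_C2(1) by (simp add: DERIV_deriv_iff_real_differentiable)
    show "continuous_on UNIV (deriv Phi)"
      using Phi_C2(2) by (metis differentiable_imp_continuous_on differentiable_on_def differentiable_at_withinI)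
  qed (use pos Phi_sconv Phi1 k_neg in auto)
  \<comment> \<open>Equality as functions of \<open>y\<close>, for each admissible \<open>c\<close>,
    transfers derivatives and limits in the first variable at once.\<close>
  have Wc: "(\<lambda>y. Wc y c) = (\<lambda>y. fb.Wc y c)" if "c \<in> {0..<1}" for c
    unfolding Wc_def using fb.W_c_vector_derivative[OF that] by simp
  have W: "((\<lambda>d. W x d) has_real_derivative fb.Wc x c) (at c within {0..<1})" if "c \<in> {0..<1}" for x c
    unfolding W_def using fb.W_deriv_c[OF that] .
  show ?thesis
  proof (intro conjI ballI allI impI)
    fix c :: real assume c: "c \<in> {0..<1}"
    show "\<exists>!x. \<psi> x / deriv \<psi> x = x - x0 c" unfolding \<psi>_def by (rule fb.boundary_equation_ex1)
    show "\<gamma> c > x0 c" unfolding \<gamma>_def x0_def by (rule fb.\<gamma>_gt)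
    show "(\<lambda>y. W y c) differentiable (at x)" "deriv (\<lambda>y. W y c) differentiable (at x)"
      "1/2 * sg\<^sup>2 * deriv (deriv (\<lambda>y. W y c)) x + th * (mu - x) * deriv (\<lambda>y. W y c) x - lam * W x c
        = - lam * x * Phi c" if "x < \<gamma> c" for x
      using fb.W_continuation_ode[OF c that[unfolded \<gamma>_def]] unfolding W_def by blast+
    show "\<exists>w. ((\<lambda>d. W x d) has_real_derivative w) (at c within {0..<1}) \<and> w \<ge> - x" for x
      using W[OF c] fb.Wc_ge[OF c] by blast
    show "W x c = x * (1 - c)" if "x \<ge> \<gamma> c" for x
      using that fb.W_eq[OF c, of x] unfolding W_def \<gamma>_def by simp
    show "((\<lambda>y. W y c) has_real_derivative (1 - c)) (at (\<gamma> c))"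
      using fb.W_deriv_x[OF c, of "\<gamma> c"] unfolding W_def by (simp add: fb.Wx_def \<gamma>_def)
    show "((\<lambda>d. W (\<gamma> c) d) has_real_derivative (- \<gamma> c)) (at c within {0..<1})"
      using W[OF c, of "\<gamma> c"] by (simp add: fb.Wc_def \<gamma>_def)
    show "(\<lambda>y. Wc y c) differentiable (at x)" if "x < \<gamma> c" for x
      unfolding Wc[OF c] using fb.Wc_kink(1)[OF c that[unfolded \<gamma>_def]] real_differentiable_def by blast
    show "\<exists>L. L < -1 \<and> (deriv (\<lambda>y. Wc y c) \<longlongrightarrow> L) (at_left (\<gamma> c))"
      unfolding Wc[OF c] \<gamma>_def using fb.Wc_kink(3)[OF c] fb.V_\<gamma>(5)[OF c] by blast
    show "((\<lambda>y. Wc y c) has_real_derivative (-1)) (at x)" if "x > \<gamma> c" for x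
      unfolding Wc[OF c] by (rule fb.Wc_kink(2)[OF c that[unfolded \<gamma>_def]])
    show "\<not> ((\<lambda>y. Wc y c) differentiable (at (\<gamma> c)))"
      unfolding Wc[OF c] \<gamma>_def by (rule fb.Wc_kink(4)[OF c])
  next
    show "\<gamma> c2 < \<gamma> c1" if "0 \<le> c1 \<and> c1 < c2 \<and> c2 < 1" for c1 c2
      unfolding \<gamma>_def using fb.\<gamma>_strict_antimono that by blast
    show "\<exists>D. continuous_on {0..<1} D \<and> (\<forall>c\<in>{0..<1}. (\<gamma> has_real_derivative D c) (at c within {0..<1}))"
      unfolding \<gamma>_def
      by (intro exI[of _ fb.dgam] conjI ballI fb.dgam_cont has_field_derivative_at_within[OF fb.\<gamma>_deriv])
    show "W21inf_loc (UNIV \<times> {0<..<1}) (\<lambda>(x, c). W x c)"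
      unfolding W_def by (rule fb.W_sobolev)
  qed
qed

end
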